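(* Let $\Gamma$ be a non-abelian, non-discrete, elementary subgroup of $\mathrm{PSL}_2(\mathbb{R})$, let $k$ be a nonzero real number and let $\nu$ be a multiplier system of weight $k$ for $\Gamma$. (1) Suppose that $\bigcap_{\gamma\in\Gamma}\mathrm{Fix}(\gamma)=\emptyset$ and that $M_u(\Gamma,k,\nu)$ is non-trivial. Then $M_u(\Gamma,k,\nu)$ has dimension $1$ and, after a conjugation in $\mathrm{PSL}_2(\mathbb{R})$, it is generated by $f(z)=z^{-k/2}$, $z\in\mathbb{H}$; that is, there is $L\in\mathrm{SL}_2(\mathbb{R})$ such that $\{f|_kL : f\in M_u(\Gamma,k,\nu)\}=\mathbb{C}\,z^{-k/2}$. (2) If $\bigcap_{\gamma\in\Gamma}\mathrm{Fix}(\gamma)\neq\emptyset$, then $M_u(\Gamma,k,\nu)=\{0\}$.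
   Context: $\mathbb{H}$ is the upper half-plane; $\mathrm{PSL}_2(\mathbb{R})=\mathrm{SL}_2(\mathbb{R})/\{\pm I\}$, with its usual topology, acts on $\widehat{\mathbb{C}}=\mathbb{C}\cup\{\infty\}$ by Möbius transformations, preserving $\mathbb{H}$ and $\mathbb{R}\cup\{\infty\}$. $\mathrm{Fix}(\gamma)\subset\widehat{\mathbb{C}}$ is the set of fixed points of $\gamma$. A subgroup is elementary if it has a finite orbit in $\mathbb{H}\cup\mathbb{R}\cup\{\infty\}$. Let $\widetilde\Gamma\subset\mathrm{SL}_2(\mathbb{R})$ be the preimage of $\Gamma$. Real powers are taken with the principal branch of the logarithm. For $L=\begin{pmatrix}a&b\\c&d\end{pmatrix}\in\mathrm{SL}_2(\mathbb{R})$, $(f|_kL)(z)=(cz+d)^{-k}f(Lz)$. A multiplier system of weight $k\in\mathbb{R}$ for $\Gamma$ is a function $\nu:\widetilde\Gamma\to\{w\in\mathbb{C}:|w|=1\}$ such that $\mu_\gamma(z)=\nu(\gamma)(cz+d)^k$, for $\gamma=\begin{pmatrix}a&b\\c&d\end{pmatrix}\in\widetilde\Gamma$ and $z\in\mathbb{H}$, satisfies $\mu_{\alpha\gamma}(z)=\mu_\alpha(\gamma z)\mu_\gamma(z)$ and $\mu_{-\gamma}(z)=\mu_\gamma(z)$ for all $\alpha,\gamma\in\widetilde\Gamma$, $z\in\mathbb{H}$. $M_u(\Gamma,k,\nu)$ is the complex vector space of meromorphic functions $f$ on $\mathbb{H}$ with $f|_k\gamma=\nu(\gamma)f$ for all $\gamma\in\widetilde\Gamma$.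 If $f\in M_u(\Gamma,k,\nu)$, then $f|_kL$ is an unrestricted automorphic form of weight $k$ for $L^{-1}\Gamma L$ (with a suitable multiplier system); "after a conjugation" refers to this replacement. *)

theory Defs
  imports "HOL-Complex_Analysis.Complex_Analysis" "HOL-Algebra.Group_Action"
begin

section \<open>The groups $\mathrm{SL}_2(\mathbb{R})$ and $\mathrm{PSL}_2(\mathbb{R})$\<close>

definition SL2 :: "(real^2^2) monoid" where
  "SL2 = \<lparr>carrier = {A. det A = 1}, mult = (**), one = mat 1\<rparr>"

definition PSL2 :: "(real^2^2) set monoid" where
  "PSL2 = SL2 Mod {mat 1, - mat 1}"

definition to_PSL2 :: "real^2^2 \<Rightarrow> (real^2^2) set" where
  "to_PSL2 A = {mat 1, - mat 1} #>\<^bsub>SL2\<^esub> A"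

definition PSL2_topology :: "(real^2^2) set topology" where
  "PSL2_topology = topology (\<lambda>U. U \<subseteq> carrier PSL2 \<and>
     openin (top_of_set (carrier SL2)) {A \<in> carrier SL2. to_PSL2 A \<in> U})"

definition discrete_subgroup :: "(real^2^2) set set \<Rightarrow> bool" where
  "discrete_subgroup \<Gamma> \<longleftrightarrow> subtopology PSL2_topology \<Gamma> = discrete_topology \<Gamma>"

definition SL2_preimage :: "(real^2^2) set set \<Rightarrow> (real^2^2) set" where
  "SL2_preimage \<Gamma> = {A \<in> carrier SL2. to_PSL2 A \<in> \<Gamma>}"

lemma carrier_SL2: "A \<in> carrier SL2 \<longleftrightarrow> A $ 1 $ 1 * A $ 2 $ 2 - A $ 1 $ 2 * A $ 2 $ 1 = 1"
  by (simp add: SL2_def det_2)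

lemma group_SL2: "group SL2"
proof (rule groupI)
  fix A assume A: "A \<in> carrier SL2"
  hence "invertible A" by (simp add: SL2_def invertible_det_nz)
  then obtain B where B: "B ** A = mat 1" by (auto simp: invertible_def)
  hence "det B * det A = 1" by (metis det_I det_mul)
  with A B show "\<exists>B\<in>carrier SL2. B \<otimes>\<^bsub>SL2\<^esub> A = \<one>\<^bsub>SL2\<^esub>"
    by (auto simp: SL2_def)
qed (auto simp: SL2_def det_mul matrix_mul_assoc)

lemma matrix_minus_mult:
  fixes A B :: "real^2^2"
  shows "(- A) ** B = - (A ** B)" "A ** (- B) = - (A ** B)"
  by (simp_all add: matrix_matrix_mult_def vec_eq_iff sum_negf)

lemma center_normal: "{mat 1, - mat 1} \<lhd> SL2"
proof -
  interpret group SL2 by (rule group_SL2)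
  have m: "- mat 1 \<in> carrier SL2"
    by (simp add: carrier_SL2 mat_def)
  have mm: "- mat 1 \<otimes>\<^bsub>SL2\<^esub> - mat 1 = mat 1"
    by (simp add: SL2_def matrix_minus_mult)
  hence invm: "inv\<^bsub>SL2\<^esub> (- mat 1) = - mat 1"
    using m by (intro inv_equality) (auto simp: SL2_def)
  have sub: "subgroup {mat 1, - mat 1} SL2"
  proof
    show "{mat 1, - mat 1} \<subseteq> carrier SL2" using m by (auto simp: SL2_def)
    show "\<one>\<^bsub>SL2\<^esub> \<in> {mat 1, - mat 1}" by (simp add: SL2_def)
    fix x assume x: "x \<in> {mat 1, - mat 1 :: real^2^2}"
    show "inv\<^bsub>SL2\<^esub> x \<in> {mat 1, - mat 1}"
      using x invm inv_one by (auto simp: SL2_def)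
    fix y assume "y \<in> {mat 1, - mat 1 :: real^2^2}"
    with x show "x \<otimes>\<^bsub>SL2\<^esub> y \<in> {mat 1, - mat 1}"
      by (auto simp: SL2_def matrix_minus_mult)
  qed
  show ?thesis
    by (rule normalI[OF sub]) (auto simp: r_coset_def l_coset_def SL2_def matrix_minus_mult)
qed

lemma group_PSL2: "group PSL2"
  unfolding PSL2_def by (rule normal.factorgroup_is_group[OF center_normal])

lemma to_PSL2_eq: "to_PSL2 A = {A, - A}"
  by (auto simp: to_PSL2_def r_coset_def SL2_def matrix_minus_mult)

lemma carrier_PSL2: "carrier PSL2 = to_PSL2 ` carrier SL2"
  by (auto simp: PSL2_def FactGroup_def RCOSETS_def to_PSL2_def)

lemma openin_PSL2_topology:
  "openin PSL2_topology U \<longleftrightarrow> U \<subseteq> carrier PSL2 \<and>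
     openin (top_of_set (carrier SL2)) {A \<in> carrier SL2. to_PSL2 A \<in> U}"
proof -
  let ?p = "\<lambda>U. {A \<in> carrier SL2. to_PSL2 A \<in> U}"
  have i: "?p (U \<inter> V) = ?p U \<inter> ?p V" for U V by auto
  have u: "?p (\<Union>K) = (\<Union>U\<in>K. ?p U)" for K by auto
  have "istopology (\<lambda>U. U \<subseteq> carrier PSL2 \<and> openin (top_of_set (carrier SL2)) (?p U))"
    unfolding istopology_def i u by (auto intro!: openin_Int)
  thus ?thesis unfolding PSL2_topology_def by simp
qed

lemma topspace_PSL2: "topspace PSL2_topology = carrier PSL2"
proof -
  have "{A \<in> carrier SL2. to_PSL2 A \<in> carrier PSL2} = carrier SL2"
    by (auto simp: carrier_PSL2)
  hence "openin PSL2_topology (carrier PSL2)"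
    by (simp add: openin_PSL2_topology)
  moreover have "topspace PSL2_topology \<subseteq> carrier PSL2"
    using openin_PSL2_topology openin_topspace by blast
  ultimately show ?thesis by (meson openin_subset subset_antisym)
qed

lemma quotient_map_to_PSL2: "quotient_map (top_of_set (carrier SL2)) PSL2_topology to_PSL2"
  by (auto simp: quotient_map_def topspace_PSL2 carrier_PSL2 openin_PSL2_topology)

section \<open>Action on the Riemann sphere\<close>

abbreviation uhp :: "complex set" where
  "uhp \<equiv> {z. Im z > 0}"

definition aut_factor :: "real^2^2 \<Rightarrow> complex \<Rightarrow> complex" where
  "aut_factor A z = of_real (A $ 2 $ 1) * z + of_real (A $ 2 $ 2)"

definition moebius_map :: "real^2^2 \<Rightarrow> complex \<Rightarrow> complex" where
  "moebius_map A z = (of_real (A $ 1 $ 1) * z + of_real (A $ 1 $ 2)) / aut_factor A z"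

text \<open>The Riemann sphere is \<^typ>\<open>complex option\<close>, with \<^term>\<open>None\<close> the point at infinity.\<close>

definition sphere_act :: "real^2^2 \<Rightarrow> complex option \<Rightarrow> complex option" where
  "sphere_act A p = (case p of
       None \<Rightarrow> if A $ 2 $ 1 = 0 then None else Some (of_real (A $ 1 $ 1) / of_real (A $ 2 $ 1))
     | Some z \<Rightarrow> if aut_factor A z = 0 then None else Some (moebius_map A z))"

definition PSL2_act :: "(real^2^2) set \<Rightarrow> complex option \<Rightarrow> complex option" where
  "PSL2_act \<gamma> p = the_elem ((\<lambda>A. sphere_act A p) ` \<gamma>)"

definition Fix :: "(real^2^2) set \<Rightarrow> complex option set" where
  "Fix \<gamma> = {p. PSL2_act \<gamma> p = p}"

definition elementary :: "(real^2^2) set set \<Rightarrow> bool" where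
  "elementary \<Gamma> \<longleftrightarrow> (\<exists>p \<in> Some ` (uhp \<union> \<real>) \<union> {None}.
     finite (orbit (PSL2\<lparr>carrier := \<Gamma>\<rparr>) PSL2_act p))"

lemma aut_factor_minus: "aut_factor (- A) z = - aut_factor A z"
  by (simp add: aut_factor_def)

lemma moebius_minus: "moebius_map (- A) z = moebius_map A z"
  unfolding moebius_map_def aut_factor_minus
  by (metis (no_types, lifting) minus_add_distrib minus_divide_divide minus_mult_left
      of_real_minus vector_uminus_component)

lemma PSL2_act_to_PSL2: "PSL2_act (to_PSL2 A) p = sphere_act A p"
proof -
  have "sphere_act (- A) p = sphere_act A p"
    by (simp add: sphere_act_def moebius_minus aut_factor_minus split: option.split)
  thus ?thesis by (simp add: PSL2_act_def to_PSL2_eq)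
qed

lemma aut_factor_nonzero:
  assumes "A \<in> carrier SL2" "z \<in> uhp"
  shows "aut_factor A z \<noteq> 0"
proof
  assume "aut_factor A z = 0"
  hence "Im (aut_factor A z) = 0" "Re (aut_factor A z) = 0" by simp_all
  hence "A $ 2 $ 1 = 0" "A $ 2 $ 2 = 0" using assms(2) by (auto simp: aut_factor_def)
  with assms(1) show False by (simp add: carrier_SL2)
qed

lemma moebius_uhp:
  assumes "A \<in> carrier SL2" "z \<in> uhp"
  shows "moebius_map A z \<in> uhp"
proof -
  let ?w = "aut_factor A z"
  have "Im (moebius_map A z) = Im ((of_real (A $ 1 $ 1) * z + of_real (A $ 1 $ 2)) * cnj ?w) / (cmod ?w)\<^sup>2"
    unfolding moebius_map_def by (subst complex_div_cnj) (simp flip: of_real_power)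
  also have "Im ((of_real (A $ 1 $ 1) * z + of_real (A $ 1 $ 2)) * cnj ?w)
      = (A $ 1 $ 1 * A $ 2 $ 2 - A $ 1 $ 2 * A $ 2 $ 1) * Im z"
    by (simp add: aut_factor_def algebra_simps)
  also have "\<dots> = Im z" using assms(1) by (simp add: carrier_SL2)
  finally show ?thesis using assms aut_factor_nonzero[OF assms] by simp
qed

lemma moebius_analytic:
  assumes "A \<in> carrier SL2"
  shows "moebius_map A analytic_on uhp"
  unfolding moebius_map_def using aut_factor_nonzero[OF assms]
  by (auto simp: aut_factor_def intro!: analytic_intros)

lemma moebius_inj:
  assumes "A \<in> carrier SL2" "z \<in> uhp" "w \<in> uhp" "moebius_map A z = moebius_map A w"
  shows "z = w"
proof -
  define a b c d where abcd: "a = complex_of_real (A $ 1 $ 1)" "b = complex_of_real (A $ 1 $ 2)"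
    "c = complex_of_real (A $ 2 $ 1)" "d = complex_of_real (A $ 2 $ 2)"
  have det: "a * d - b * c = 1"
    unfolding abcd using assms(1)[unfolded carrier_SL2]
    by (metis of_real_1 of_real_diff of_real_mult)
  have "(a * z + b) * (c * w + d) = (a * w + b) * (c * z + d)"
    using assms(4) aut_factor_nonzero[OF assms(1,2)] aut_factor_nonzero[OF assms(1,3)]
    by (simp add: moebius_map_def aut_factor_def abcd frac_eq_eq)
  hence "(a * d - b * c) * (z - w) = 0" by (simp add: algebra_simps)
  thus ?thesis using det by simp
qed

section \<open>Meromorphic functions on the upper half-plane\<close>

text \<open>
  A meromorphic function is represented by its canonical representative, which is continuous
  away from the poles and, by convention, \<^term>\<open>0\<close> at the poles and outside the half-plane. Since
  pointwise operations may create removable singularities, they are followed by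
  \<^const>\<open>remove_sings\<close>.
\<close>

typedef mero = "{f. f nicely_meromorphic_on uhp \<and> (\<forall>z. z \<notin> uhp \<longrightarrow> f z = 0)}"
  morphisms mero_fun Abs_mero
  by (rule exI[of _ "\<lambda>_. 0"]) auto

definition mero_of :: "(complex \<Rightarrow> complex) \<Rightarrow> mero" where
  "mero_of g = Abs_mero (\<lambda>z. if z \<in> uhp then remove_sings g z else 0)"

lemma open_uhp: "open uhp"
  by (rule open_halfspace_Im_gt)

lemma eventually_uhp: "z \<in> uhp \<Longrightarrow> eventually (\<lambda>w. w \<in> uhp) (at z)"
  using open_uhp by (rule eventually_at_in_open')

lemma nicely_cong_uhp:
  assumes "\<And>z. z \<in> uhp \<Longrightarrow> f z = g z" "g nicely_meromorphic_on uhp"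
  shows "f nicely_meromorphic_on uhp"
proof -
  have ev: "eventually (\<lambda>w. f w = g w) (at z)" if "z \<in> uhp" for z
    using eventually_uhp[OF that] by eventually_elim (rule assms(1))
  have "f meromorphic_on uhp \<longleftrightarrow> g meromorphic_on uhp"
    by (rule meromorphic_on_cong) (use ev in auto)
  moreover have "is_pole f z \<longleftrightarrow> is_pole g z" if "z \<in> uhp" for z
    by (rule is_pole_cong[OF ev[OF that] refl])
  moreover have "f \<midarrow>z\<rightarrow> f z \<longleftrightarrow> g \<midarrow>z\<rightarrow> g z" if "z \<in> uhp" for z
    using assms(1)[OF that] by (simp add: filterlim_cong[OF refl refl ev[OF that]])
  ultimately show ?thesis
    using assms unfolding nicely_meromorphic_on_def by auto
qed

lemma mero_fun_mero_of:
  assumes "g meromorphic_on uhp"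
  shows "mero_fun (mero_of g) = (\<lambda>z. if z \<in> uhp then remove_sings g z else 0)"
  unfolding mero_of_def
proof (rule Abs_mero_inverse, intro CollectI conjI allI impI)
  show "(\<lambda>z. if z \<in> uhp then remove_sings g z else 0) nicely_meromorphic_on uhp"
    by (rule nicely_cong_uhp[OF _ remove_sings_nicely_meromorphic[OF assms]]) auto
  fix z assume "z \<notin> uhp"
  thus "(if z \<in> uhp then remove_sings g z else 0) = 0" by (rule if_not_P)
qed

lemma eventually_mero_fun_mero_of:
  assumes "g meromorphic_on uhp" "z \<in> uhp"
  shows "eventually (\<lambda>w. mero_fun (mero_of g) w = g w) (at z)"
proof -
  have "eventually (\<lambda>w. remove_sings g w = g w) (at z)"
    using assms meromorphic_on_isolated_singularity
    by (intro eventually_remove_sings_eq_at) (auto intro: meromorphic_on_subset)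
  thus ?thesis using eventually_uhp[OF assms(2)]
    by eventually_elim (simp add: mero_fun_mero_of[OF assms(1)])
qed

lemma mero_of_cong:
  assumes "\<And>z. z \<in> uhp \<Longrightarrow> eventually (\<lambda>w. f w = g w) (at z)"
  shows "mero_of f = mero_of g"
  unfolding mero_of_def using remove_sings_cong[OF assms refl]
  by (intro arg_cong[of _ _ Abs_mero]) auto

lemma nicely_mero_fun: "mero_fun f nicely_meromorphic_on uhp"
  using mero_fun[of f] by simp

lemma mero_fun_meromorphic [simp]: "mero_fun f meromorphic_on uhp"
  using nicely_mero_fun nicely_meromorphic_on_def by blast

lemma mero_fun_outside: "z \<notin> uhp \<Longrightarrow> mero_fun f z = 0"
  using mero_fun[of f] by blast

lemma mero_of_mero_fun [simp]: "mero_of (mero_fun f) = f"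
proof -
  have "(\<lambda>z. if z \<in> uhp then remove_sings (mero_fun f) z else 0) = mero_fun f"
  proof
    fix z
    have "remove_sings (mero_fun f) z = mero_fun f z" if "z \<in> uhp"
      using nicely_mero_fun[of f] that unfolding nicely_meromorphic_on_def by fastforce
    thus "(if z \<in> uhp then remove_sings (mero_fun f) z else 0) = mero_fun f z"
      by (auto simp: mero_fun_outside)
  qed
  thus ?thesis unfolding mero_of_def by (simp add: mero_fun_inverse)
qed

instantiation mero :: ab_group_add
begin

definition zero_mero :: mero where "0 = mero_of (\<lambda>_. 0)"
definition plus_mero :: "mero \<Rightarrow> mero \<Rightarrow> mero" where
  "f + g = mero_of (\<lambda>z. mero_fun f z + mero_fun g z)"
definition uminus_mero :: "mero \<Rightarrow> mero" where
  "- f = mero_of (\<lambda>z. - mero_fun f z)"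
definition minus_mero :: "mero \<Rightarrow> mero \<Rightarrow> mero" where
  "f - g = mero_of (\<lambda>z. mero_fun f z - mero_fun g z)"

lemma eventually_mero_plus:
  "z \<in> uhp \<Longrightarrow> eventually (\<lambda>w. mero_fun (f + g) w = mero_fun f w + mero_fun g w) (at z)"
  unfolding plus_mero_def by (intro eventually_mero_fun_mero_of meromorphic_intros) auto

lemma eventually_mero_uminus:
  "z \<in> uhp \<Longrightarrow> eventually (\<lambda>w. mero_fun (- f) w = - mero_fun f w) (at z)"
  unfolding uminus_mero_def by (intro eventually_mero_fun_mero_of meromorphic_intros) auto

lemma eventually_mero_zero:
  "z \<in> uhp \<Longrightarrow> eventually (\<lambda>w. mero_fun 0 w = 0) (at z)"
  unfolding zero_mero_def by (intro eventually_mero_fun_mero_of meromorphic_intros) auto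

lemma mero_eqI:
  assumes "\<And>z. z \<in> uhp \<Longrightarrow> eventually (\<lambda>w. mero_fun f w = mero_fun g w) (at z)"
  shows "f = g"
  using mero_of_cong[OF assms] by simp

instance
proof
  fix f g h :: mero
  show "f + g + h = f + (g + h)"
  proof (rule mero_eqI)
    fix z assume z: "z \<in> uhp"
    show "eventually (\<lambda>w. mero_fun (f + g + h) w = mero_fun (f + (g + h)) w) (at z)"
      using eventually_mero_plus[OF z, of "f + g" h] eventually_mero_plus[OF z, of f g]
        eventually_mero_plus[OF z, of f "g + h"] eventually_mero_plus[OF z, of g h]
      by eventually_elim simp
  qed
  show "f + g = g + f"
    by (simp add: plus_mero_def add.commute)
  show "0 + f = f"
  proof (rule mero_eqI)
    fix z assume z: "z \<in> uhp"
    show "eventually (\<lambda>w. mero_fun (0 + f) w = mero_fun f w) (at z)"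
      using eventually_mero_plus[OF z, of 0 f] eventually_mero_zero[OF z]
      by eventually_elim simp
  qed
  show "- f + f = 0"
  proof (rule mero_eqI)
    fix z assume z: "z \<in> uhp"
    show "eventually (\<lambda>w. mero_fun (- f + f) w = mero_fun 0 w) (at z)"
      using eventually_mero_plus[OF z, of "- f" f] eventually_mero_uminus[OF z, of f]
        eventually_mero_zero[OF z]
      by eventually_elim simp
  qed
  show "f - g = f + - g"
    unfolding minus_mero_def plus_mero_def
  proof (rule mero_of_cong)
    fix z assume z: "z \<in> uhp"
    show "eventually (\<lambda>w. mero_fun f w - mero_fun g w = mero_fun f w + mero_fun (- g) w) (at z)"
      using eventually_mero_uminus[OF z, of g] by eventually_elim simp
  qed
qed

end

definition mero_scale :: "complex \<Rightarrow> mero \<Rightarrow> mero" where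
  "mero_scale c f = mero_of (\<lambda>z. c * mero_fun f z)"

lemma eventually_mero_scale:
  "z \<in> uhp \<Longrightarrow> eventually (\<lambda>w. mero_fun (mero_scale c f) w = c * mero_fun f w) (at z)"
  unfolding mero_scale_def by (intro eventually_mero_fun_mero_of meromorphic_intros) auto

interpretation mero: vector_space mero_scale
proof
  fix a b :: complex and f g :: mero
  show "mero_scale a (f + g) = mero_scale a f + mero_scale a g"
  proof (rule mero_eqI)
    fix z assume z: "z \<in> uhp"
    show "eventually (\<lambda>w. mero_fun (mero_scale a (f + g)) w = mero_fun (mero_scale a f + mero_scale a g) w) (at z)"
      using eventually_mero_scale[OF z, of a "f + g"] eventually_mero_plus[OF z, of f g]
        eventually_mero_plus[OF z, of "mero_scale a f" "mero_scale a g"]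
        eventually_mero_scale[OF z, of a f] eventually_mero_scale[OF z, of a g]
      by eventually_elim (simp add: algebra_simps)
  qed
  show "mero_scale (a + b) f = mero_scale a f + mero_scale b f"
  proof (rule mero_eqI)
    fix z assume z: "z \<in> uhp"
    show "eventually (\<lambda>w. mero_fun (mero_scale (a + b) f) w = mero_fun (mero_scale a f + mero_scale b f) w) (at z)"
      using eventually_mero_scale[OF z, of "a + b" f]
        eventually_mero_plus[OF z, of "mero_scale a f" "mero_scale b f"]
        eventually_mero_scale[OF z, of a f] eventually_mero_scale[OF z, of b f]
      by eventually_elim (simp add: algebra_simps)
  qed
  show "mero_scale a (mero_scale b f) = mero_scale (a * b) f"
  proof (rule mero_eqI)
    fix z assume z: "z \<in> uhp"
    show "eventually (\<lambda>w. mero_fun (mero_scale a (mero_scale b f)) w = mero_fun (mero_scale (a * b) f) w) (at z)"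
      using eventually_mero_scale[OF z, of a "mero_scale b f"]
        eventually_mero_scale[OF z, of b f] eventually_mero_scale[OF z, of "a * b" f]
      by eventually_elim (simp add: algebra_simps)
  qed
  show "mero_scale 1 f = f"
    by (simp add: mero_scale_def)
qed

section \<open>Unrestricted automorphic forms\<close>

text \<open>
  \<^term>\<open>w powr of_real k\<close> is \<^term>\<open>exp (of_real k * Ln w)\<close> for nonzero \<^term>\<open>w\<close>, with the branch of
  \<^const>\<open>Ln\<close> whose imaginary part lies in $(-\pi, \pi]$.
\<close>

definition slash :: "real \<Rightarrow> real^2^2 \<Rightarrow> mero \<Rightarrow> mero" where
  "slash k L f = mero_of (\<lambda>z. aut_factor L z powr of_real (- k) * mero_fun f (moebius_map L z))"

definition multiplier_system :: "(real^2^2) set set \<Rightarrow> real \<Rightarrow> (real^2^2 \<Rightarrow> complex) \<Rightarrow> bool" where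
  "multiplier_system \<Gamma> k \<nu> \<longleftrightarrow>
     (\<forall>\<gamma> \<in> SL2_preimage \<Gamma>. cmod (\<nu> \<gamma>) = 1) \<and>
     (let \<mu> = (\<lambda>\<gamma> z. \<nu> \<gamma> * aut_factor \<gamma> z powr of_real k) in
       \<forall>\<alpha> \<in> SL2_preimage \<Gamma>. \<forall>\<gamma> \<in> SL2_preimage \<Gamma>. \<forall>z \<in> uhp.
         \<mu> (\<alpha> ** \<gamma>) z = \<mu> \<alpha> (moebius_map \<gamma> z) * \<mu> \<gamma> z \<and> \<mu> (- \<gamma>) z = \<mu> \<gamma> z)"

definition M_u :: "(real^2^2) set set \<Rightarrow> real \<Rightarrow> (real^2^2 \<Rightarrow> complex) \<Rightarrow> mero set" where
  "M_u \<Gamma> k \<nu> = {f. \<forall>\<gamma> \<in> SL2_preimage \<Gamma>. slash k \<gamma> f = mero_scale (\<nu> \<gamma>) f}"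

lemma aut_factor_powr_analytic:
  assumes "A \<in> carrier SL2"
  shows "(\<lambda>z. aut_factor A z powr s) analytic_on uhp"
proof (cases "A $ 2 $ 1 = 0")
  case True
  thus ?thesis by (simp add: aut_factor_def)
next
  case False
  have "aut_factor A z \<notin> \<real>\<^sub>\<le>\<^sub>0" if "z \<in> uhp" for z
  proof
    assume "aut_factor A z \<in> \<real>\<^sub>\<le>\<^sub>0"
    hence "Im (aut_factor A z) = 0" by (auto simp: complex_nonpos_Reals_iff)
    thus False using False that by (simp add: aut_factor_def)
  qed
  thus ?thesis unfolding aut_factor_def by (auto intro!: analytic_intros)
qed

lemma slash_meromorphic:
  assumes "L \<in> carrier SL2"
  shows "(\<lambda>z. aut_factor L z powr s * mero_fun f (moebius_map L z)) meromorphic_on uhp"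
proof (rule meromorphic_on_mult)
  show "(\<lambda>z. aut_factor L z powr s) meromorphic_on uhp"
    by (intro analytic_on_imp_meromorphic_on aut_factor_powr_analytic assms)
  show "(\<lambda>z. mero_fun f (moebius_map L z)) meromorphic_on uhp"
    by (rule meromorphic_on_compose[OF mero_fun_meromorphic moebius_analytic[OF assms]])
       (use moebius_uhp[OF assms] in auto)
qed

lemma filterlim_moebius:
  assumes L: "L \<in> carrier SL2" and z: "z \<in> uhp"
  shows "filterlim (moebius_map L) (at (moebius_map L z)) (at z)"
proof -
  have "moebius_map L analytic_on {z}"
    using moebius_analytic[OF L] by (rule analytic_on_subset) (use z in auto)
  hence "moebius_map L \<midarrow>z\<rightarrow> moebius_map L z"
    by (intro isContD analytic_at_imp_isCont)
  moreover have "eventually (\<lambda>w. moebius_map L w \<noteq> moebius_map L z) (at z)"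
    using eventually_uhp[OF z] eventually_neq_at_within[of z]
    by eventually_elim (use moebius_inj[OF L _ z] in blast)
  ultimately show ?thesis by (simp add: filterlim_at)
qed

lemma mero_fun_slash:
  assumes L: "L \<in> carrier SL2" and z: "z \<in> uhp"
  shows "mero_fun (slash k L f) z
    = aut_factor L z powr of_real (- k) * mero_fun f (moebius_map L z)"
proof -
  let ?h = "\<lambda>z. aut_factor L z powr of_real (- k)"
  let ?g = "\<lambda>z. ?h z * mero_fun f (moebius_map L z)"
  have "?h analytic_on {z}"
    using aut_factor_powr_analytic[OF L] by (rule analytic_on_subset) (use z in auto)
  hence h: "?h \<midarrow>z\<rightarrow> ?h z" by (intro isContD analytic_at_imp_isCont)
  have nz: "?h z \<noteq> 0" using aut_factor_nonzero[OF L z] by simp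
  note m = filterlim_moebius[OF L z]
  have "remove_sings ?g z = ?g z"
  proof (cases "is_pole (mero_fun f) (moebius_map L z) \<and> mero_fun f (moebius_map L z) = 0")
    case True
    hence "filterlim (\<lambda>w. mero_fun f (moebius_map L w)) at_infinity (at z)"
      unfolding is_pole_def using filterlim_compose[OF _ m] by blast
    hence "is_pole ?g z"
      unfolding is_pole_def by (rule tendsto_mult_filterlim_at_infinity[OF h nz])
    thus ?thesis using True by simp
  next
    case False
    hence "mero_fun f \<midarrow>moebius_map L z\<rightarrow> mero_fun f (moebius_map L z)"
      using nicely_mero_fun[of f] moebius_uhp[OF L z] unfolding nicely_meromorphic_on_def by blast
    hence "(\<lambda>w. mero_fun f (moebius_map L w)) \<midarrow>z\<rightarrow> mero_fun f (moebius_map L z)"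
      using filterlim_compose[OF _ m] by blast
    thus ?thesis by (intro remove_sings_eqI tendsto_mult h)
  qed
  thus ?thesis
    unfolding slash_def using z by (simp add: mero_fun_mero_of[OF slash_meromorphic[OF L]])
qed

lemma eventually_slash:
  assumes "L \<in> carrier SL2" "z \<in> uhp"
  shows "eventually (\<lambda>w. mero_fun (slash k L f) w
    = aut_factor L w powr of_real (- k) * mero_fun f (moebius_map L w)) (at z)"
  using eventually_uhp[OF assms(2)] by eventually_elim (rule mero_fun_slash[OF assms(1)])

lemma slash_add:
  assumes L: "L \<in> carrier SL2"
  shows "slash k L (f + g) = slash k L f + slash k L g"
proof (rule mero_eqI)
  fix z assume z: "z \<in> uhp"
  have "eventually (\<lambda>w. mero_fun (f + g) (moebius_map L w)
      = mero_fun f (moebius_map L w) + mero_fun g (moebius_map L w)) (at z)"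
    using eventually_compose_filterlim[OF eventually_mero_plus[OF moebius_uhp[OF L z]]
        filterlim_moebius[OF L z]] .
  thus "eventually (\<lambda>w. mero_fun (slash k L (f + g)) w
      = mero_fun (slash k L f + slash k L g) w) (at z)"
    using eventually_slash[OF L z, of k "f + g"] eventually_slash[OF L z, of k f]
      eventually_slash[OF L z, of k g] eventually_mero_plus[OF z, of "slash k L f" "slash k L g"]
    by eventually_elim (simp add: algebra_simps)
qed

lemma slash_scale:
  assumes L: "L \<in> carrier SL2"
  shows "slash k L (mero_scale c f) = mero_scale c (slash k L f)"
proof (rule mero_eqI)
  fix z assume z: "z \<in> uhp"
  have "eventually (\<lambda>w. mero_fun (mero_scale c f) (moebius_map L w)
      = c * mero_fun f (moebius_map L w)) (at z)"
    using eventually_compose_filterlim[OF eventually_mero_scale[OF moebius_uhp[OF L z]]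
        filterlim_moebius[OF L z]] .
  thus "eventually (\<lambda>w. mero_fun (slash k L (mero_scale c f)) w
      = mero_fun (mero_scale c (slash k L f)) w) (at z)"
    using eventually_slash[OF L z, of k "mero_scale c f"] eventually_slash[OF L z, of k f]
      eventually_mero_scale[OF z, of c "slash k L f"]
    by eventually_elim (simp add: algebra_simps)
qed

lemma subspace_M_u: "mero.subspace (M_u \<Gamma> k \<nu>)"
proof (rule mero.subspaceI)
  have SL2: "\<gamma> \<in> carrier SL2" if "\<gamma> \<in> SL2_preimage \<Gamma>" for \<gamma>
    using that by (simp add: SL2_preimage_def)
  have "slash k \<gamma> 0 = 0" if "\<gamma> \<in> SL2_preimage \<Gamma>" for \<gamma>
    using slash_scale[OF SL2[OF that], of k 0 0] by simp
  thus "0 \<in> M_u \<Gamma> k \<nu>" by (simp add: M_u_def)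
  show "f + g \<in> M_u \<Gamma> k \<nu>" if "f \<in> M_u \<Gamma> k \<nu>" "g \<in> M_u \<Gamma> k \<nu>" for f g
    using that by (simp add: M_u_def slash_add SL2 mero.scale_right_distrib)
  show "mero_scale c f \<in> M_u \<Gamma> k \<nu>" if "f \<in> M_u \<Gamma> k \<nu>" for c f
    using that by (simp add: M_u_def slash_scale SL2 mero.scale_left_commute)
qed

lemma mero_fun_mero_of_powr:
  assumes "z \<in> uhp"
  shows "mero_fun (mero_of (\<lambda>z. z powr s)) z = z powr s"
proof -
  have "w \<notin> \<real>\<^sub>\<le>\<^sub>0" if "w \<in> uhp" for w
    using that by (auto simp: complex_nonpos_Reals_iff)
  hence a: "(\<lambda>z. z powr s) analytic_on uhp"
    by (auto intro!: analytic_intros)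
  hence "(\<lambda>z. z powr s) analytic_on {z}"
    by (rule analytic_on_subset) (use assms in auto)
  thus ?thesis using assms
    by (simp add: mero_fun_mero_of[OF analytic_on_imp_meromorphic_on[OF a]])
qed

end

theory Submission
  imports Defs
begin

text \<open>
  Since \<^term>\<open>\<nu>\<close> is unimodular, a form $f$ satisfies $|f(\gamma z)| = |cz+d|^k |f(z)|$; this weaker
  relation is stable under conjugation and has no branch ambiguity. If $f \neq 0$, elements of the
  group near the identity move any zero or pole to nearby ones, so $f$ has none, and the relation
  becomes a transformation law for $f'/f$, because holomorphic functions of equal modulus are
  proportional.

  If all of $\Gamma$ fixes a point, the point is real (stabilizers of points of the half-plane are
  abelian), say $\infty$. Commutators give arbitrarily small translations, so $f'/f$ is constant;
  an affine map with linear part $\neq 1$ forces it to vanish, so $f$ is constant and $k = 0$.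

  Otherwise, elements near the identity fix a finite orbit pointwise, so the orbit is a pair of
  boundary points, say $0, \infty$. Dilations near the identity make $z f'(z)/f(z)$ a constant $s$,
  and an element swapping the two points gives $-s = s + k$.
\<close>

(* Avoids the clash with the vector indexing operator. *)
unbundle no Formal_Power_Series.fps_syntax

section \<open>Functions on the half-plane with many symmetries of their modulus\<close>

lemma uhp_connected: "connected uhp"
  by (intro convex_connected convex_halfspace_Im_gt)

text \<open>For a real exponent the branch of the logarithm affects only the argument, so powers of
  moduli obey the rules for positive reals.\<close>

lemma norm_powr_of_real: "cmod (w powr of_real x) = cmod w powr x"
  by (simp add: norm_powr_real_powr')

section \<open>Zeros, level sets and logarithmic derivatives\<close>

text \<open>Zeros of a meromorphic function that is not identically zero are isolated, so
  accumulation excludes them. Poles are excluded as well, because the normalised representative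
  takes the value 0 there.\<close>

lemma nicely_meromorphic_zero_or_nonvanishing:
  assumes g: "g nicely_meromorphic_on uhp"
    and acc: "\<And>z. z \<in> uhp \<Longrightarrow> g z = 0 \<Longrightarrow> z islimpt {w. g w = 0}"
  shows "(\<forall>z\<in>uhp. g z = 0) \<or> (g holomorphic_on uhp \<and> (\<forall>z\<in>uhp. g z \<noteq> 0))"
proof (cases "\<forall>z\<in>uhp. g z = 0")
  case False
  hence "\<forall>\<^sub>\<approx>z\<in>uhp. g z \<noteq> 0"
    using nicely_meromorphic_imp_constant_or_avoid[OF g open_uhp uhp_connected, of 0] by blast
  hence "eventually (\<lambda>w. g w \<noteq> 0) (at z)" if "z \<in> uhp" for z
    using that open_uhp by (metis eventually_cosparse_open_eq)
  hence nz: "g z \<noteq> 0" if "z \<in> uhp" for z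
    using acc[OF that] that by (auto simp: islimpt_iff_eventually)
  have "\<not> is_pole g z" if "z \<in> uhp" for z
    using g nz[OF that] that not_tendsto_and_filterlim_at_infinity[of "at z" g "g z"]
    unfolding nicely_meromorphic_on_def is_pole_def by auto
  hence "g analytic_on uhp"
    using nicely_meromorphic_without_singularities[OF g] by blast
  thus ?thesis using nz analytic_imp_holomorphic by blast
qed simp

text \<open>This is the identity theorem for the level set of \<open>F\<close> through
  \<open>\<i>\<close>.\<close>

lemma constant_if_level_sets_accumulate:
  assumes "F holomorphic_on uhp" and acc: "\<And>z. z \<in> uhp \<Longrightarrow> z islimpt {w \<in> uhp. F w = F z}"
  obtains c where "\<And>z. z \<in> uhp \<Longrightarrow> F z = c"
proof -
  have "F constant_on uhp"
    using acc[of \<i>] by (intro analytic_continuation'[OF assms(1) open_uhp uhp_connected, of _ \<i>])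
      (auto simp: constant_on_def)
  thus ?thesis using that unfolding constant_on_def by blast
qed

text \<open>The quotient is holomorphic of modulus 1, so it attains its maximum modulus inside the
  half-plane, at \<open>\<i>\<close> for instance, and is constant.\<close>

lemma proportional_if_cmod_eq:
  assumes hol: "f holomorphic_on uhp" "g holomorphic_on uhp"
    and nz: "\<And>z. z \<in> uhp \<Longrightarrow> g z \<noteq> 0"
    and eq: "\<And>z. z \<in> uhp \<Longrightarrow> cmod (f z) = cmod (g z)"
  obtains c where "\<And>z. z \<in> uhp \<Longrightarrow> f z = c * g z"
proof -
  have "(\<lambda>z. f z / g z) holomorphic_on uhp"
    using nz by (intro holomorphic_intros hol) auto
  moreover have "cmod (f z / g z) = 1" if "z \<in> uhp" for z
    using eq[OF that] nz[OF that] by (simp add: norm_divide)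
  ultimately have "(\<lambda>z. f z / g z) constant_on uhp"
    by (intro maximum_modulus_principle[of _ uhp uhp \<i>] open_uhp uhp_connected) auto
  then obtain c where "f z / g z = c" if "z \<in> uhp" for z
    by (auto simp: constant_on_def)
  thus ?thesis using nz by (intro that[of c]) (auto simp: field_simps)
qed

text \<open>Equal moduli give \<open>g (\<phi> w) = c * (u w * g w)\<close> with an unknown constant
  \<open>c\<close>, which logarithmic differentiation removes. A relation between moduli thus
  becomes an exact law for \<open>g'/g\<close>.\<close>

lemma logderiv_transform:
  assumes hol: "g holomorphic_on uhp" and nz: "\<And>z. z \<in> uhp \<Longrightarrow> g z \<noteq> 0"
    and \<phi>: "\<And>z. z \<in> uhp \<Longrightarrow> (\<phi> has_field_derivative \<phi>' z) (at z)" "\<And>z. z \<in> uhp \<Longrightarrow> \<phi> z \<in> uhp"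
    and u: "\<And>z. z \<in> uhp \<Longrightarrow> (u has_field_derivative u' z) (at z)" "\<And>z. z \<in> uhp \<Longrightarrow> u z \<noteq> 0"
    and eq: "\<And>z. z \<in> uhp \<Longrightarrow> cmod (g (\<phi> z)) = cmod (u z) * cmod (g z)"
    and z: "z \<in> uhp"
  shows "\<phi>' z * (deriv g (\<phi> z) / g (\<phi> z)) = u' z / u z + deriv g z / g z"
proof -
  have dg: "(g has_field_derivative deriv g w) (at w)" if "w \<in> uhp" for w
    using hol open_uhp that by (rule holomorphic_derivI)
  have d1: "((\<lambda>w. g (\<phi> w)) has_field_derivative deriv g (\<phi> w) * \<phi>' w) (at w)" if "w \<in> uhp" for w
    using DERIV_chain2[OF dg[OF \<phi>(2)[OF that]] \<phi>(1)[OF that]] .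
  have d2: "((\<lambda>w. u w * g w) has_field_derivative u' w * g w + deriv g w * u w) (at w)"
    if "w \<in> uhp" for w
    using DERIV_mult[OF u(1)[OF that] dg[OF that]] by (simp add: add.commute)
  obtain c where c: "g (\<phi> w) = c * (u w * g w)" if "w \<in> uhp" for w
  proof (rule proportional_if_cmod_eq[of "\<lambda>w. g (\<phi> w)" "\<lambda>w. u w * g w"])
    show "(\<lambda>w. g (\<phi> w)) holomorphic_on uhp" "(\<lambda>w. u w * g w) holomorphic_on uhp"
      using d1 d2 open_uhp holomorphic_on_open by blast+
  qed (use nz u eq in \<open>auto simp: norm_mult\<close>)
  have "((\<lambda>w. g (\<phi> w)) has_field_derivative c * (u' z * g z + deriv g z * u z)) (at z)"
    by (rule has_field_derivative_transform_within_open[OF DERIV_cmult[OF d2[OF z]] open_uhp z])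
       (use c in auto)
  hence "deriv g (\<phi> z) * \<phi>' z = c * (u' z * g z + deriv g z * u z)"
    using d1[OF z] DERIV_unique by blast
  moreover have "c \<noteq> 0" using c[OF z] nz[OF \<phi>(2)[OF z]] by auto
  ultimately show ?thesis using c[OF z] nz[OF z] u(2)[OF z] by (simp add: field_simps)
qed

section \<open>Rigidity under translations, dilations and an inversion\<close>

text \<open>Small translations preserve the zeros of \<open>g\<close> and the level sets of
  \<open>g'/g\<close>. If \<open>g\<close> is not identically zero, it therefore has no zeros and
  \<open>g'/g\<close> is a constant \<open>c\<close>. The affine map gives \<open>a * c = c\<close>,
  so \<open>g\<close> is a nonzero constant, against \<open>K \<noteq> 1\<close>.\<close>

lemma zero_if_small_translations:
  assumes g: "g nicely_meromorphic_on uhp"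
    and T: "\<And>e::real. e > 0 \<Longrightarrow> \<exists>t::real. t \<noteq> 0 \<and> \<bar>t\<bar> < e \<and> (\<forall>z\<in>uhp. cmod (g (z + of_real t)) = cmod (g z))"
    and a: "a > 0" "a \<noteq> 1" and K: "K > 0" "K \<noteq> 1"
    and A: "\<And>z. z \<in> uhp \<Longrightarrow> cmod (g (of_real a * z + of_real b)) = K * cmod (g z)"
    and z: "z \<in> uhp"
  shows "g z = 0"
proof (rule ccontr)
  assume g0: "g z \<noteq> 0"
  have "w islimpt {w. g w = 0}" if w: "w \<in> uhp" "g w = 0" for w
    unfolding islimpt_approachable
  proof safe
    fix e :: real assume "e > 0"
    from T[OF this] obtain t :: real where "t \<noteq> 0" "\<bar>t\<bar> < e" "cmod (g (w + of_real t)) = cmod (g w)"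
      using w(1) by blast
    thus "\<exists>x'\<in>{w. g w = 0}. x' \<noteq> w \<and> dist x' w < e"
      using w(2) by (intro bexI[of _ "w + of_real t"]) (auto simp: dist_norm)
  qed
  with nicely_meromorphic_zero_or_nonvanishing[OF g] g0 z
  have hol: "g holomorphic_on uhp" and nz: "\<And>z. z \<in> uhp \<Longrightarrow> g z \<noteq> 0" by blast+
  define h where "h z = deriv g z / g z" for z
  have h: "h holomorphic_on uhp"
    unfolding h_def using nz by (intro holomorphic_intros hol open_uhp) auto
  have "w islimpt {v \<in> uhp. h v = h w}" if w: "w \<in> uhp" for w
    unfolding islimpt_approachable
  proof safe
    fix e :: real assume "e > 0"
    from T[OF this] obtain t :: real where t: "t \<noteq> 0" "\<bar>t\<bar> < e"
      "\<And>z. z \<in> uhp \<Longrightarrow> cmod (g (z + of_real t)) = cmod (g z)" by blast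
    have "((\<lambda>z. z + of_real t) has_field_derivative 1) (at z)" for z
      by (auto intro!: derivative_eq_intros)
    hence "h (w + of_real t) = h w"
      using logderiv_transform[OF hol nz, of "\<lambda>z. z + of_real t" "\<lambda>_. 1" "\<lambda>_. 1" "\<lambda>_. 0" w] t(3) w
      by (auto simp: h_def)
    thus "\<exists>x'\<in>{v \<in> uhp. h v = h w}. x' \<noteq> w \<and> dist x' w < e"
      using w t by (intro bexI[of _ "w + of_real t"]) (auto simp: dist_norm)
  qed
  then obtain c where c: "\<And>z. z \<in> uhp \<Longrightarrow> h z = c"
    using constant_if_level_sets_accumulate[OF h] by blast
  have "((\<lambda>z. of_real a * z + of_real b) has_field_derivative of_real a) (at z)" for z
    by (auto intro!: derivative_eq_intros)
  hence "of_real a * h (of_real a * z + of_real b) = h z"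
    using logderiv_transform[OF hol nz, of "\<lambda>z. of_real a * z + of_real b" "\<lambda>_. of_real a"
        "\<lambda>_. of_real K" "\<lambda>_. 0" z] A a K z
    by (auto simp: h_def)
  moreover have az: "of_real a * z + of_real b \<in> uhp" using a z by simp
  ultimately have "of_real a * c = c" using c z by simp
  hence "c = 0" using a(2) by simp
  hence d0: "deriv g z = 0" if "z \<in> uhp" for z
    using c[OF that] nz[OF that] by (simp add: h_def)
  have "g constant_on uhp"
  proof -
    have "\<exists>c. \<forall>x\<in>uhp. g x = c"
    proof (rule has_field_derivative_zero_constant)
      show "convex uhp" by (rule convex_halfspace_Im_gt)
      show "(g has_field_derivative 0) (at x within uhp)" if "x \<in> uhp" for x
        using holomorphic_derivI[OF hol open_uhp that] d0[OF that] has_field_derivative_at_within by metis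
    qed
    thus ?thesis unfolding constant_on_def by blast
  qed
  hence "g (of_real a * z + of_real b) = g z" using az z by (auto simp: constant_on_def)
  thus False using A[OF z] K g0 by simp
qed

text \<open>Dilations leave \<open>z * g'/g\<close> invariant, so it is a constant \<open>s\<close>,
  and the inversion forces \<open>- s = k + s\<close>. The resulting differential equation has only
  multiples of the power as solutions.\<close>

lemma powr_if_dilations_and_inversion:
  assumes g: "g nicely_meromorphic_on uhp"
    and D: "\<And>e::real. e > 0 \<Longrightarrow> \<exists>a K::real. a > 0 \<and> a \<noteq> 1 \<and> \<bar>a - 1\<bar> < e \<and> K > 0 \<and>
              (\<forall>z\<in>uhp. cmod (g (of_real a * z)) = K * cmod (g z))"
    and b: "b > 0" and K: "K > 0"
    and I: "\<And>z. z \<in> uhp \<Longrightarrow> cmod (g (- of_real b / z)) = K * cmod z powr k * cmod (g z)"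
  obtains C where "\<And>z. z \<in> uhp \<Longrightarrow> g z = C * z powr of_real (- k / 2)"
proof (cases "\<forall>z\<in>uhp. g z = 0")
  case True
  thus ?thesis by (intro that[of 0]) auto
next
  case False
  have nzu: "z \<noteq> 0" if "z \<in> uhp" for z using that by auto
  have npos: "z \<notin> \<real>\<^sub>\<le>\<^sub>0" if "z \<in> uhp" for z using that by (auto simp: complex_nonpos_Reals_iff)
  \<comment> \<open>Common form of two accumulation arguments: \<open>V\<close> will be the zero set
    of \<open>g\<close>, and then a level set of \<open>h\<close>.\<close>
  have acc: "w islimpt V" if w: "w \<in> uhp"
    and V: "\<And>a K. a > 0 \<Longrightarrow> K > 0 \<Longrightarrow> \<forall>z\<in>uhp. cmod (g (of_real a * z)) = K * cmod (g z) \<Longrightarrow> of_real a * w \<in> V"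
    for w V
    unfolding islimpt_approachable
  proof safe
    fix e :: real assume "e > 0"
    \<comment> \<open>A dilation by \<open>a\<close> moves \<open>w\<close> by
      \<open>\<bar>a - 1\<bar> * cmod w\<close>, hence the rescaled radius.\<close>
    hence "e / cmod w > 0" using nzu[OF w] by simp
    from D[OF this] obtain a K :: real where t: "a > 0" "a \<noteq> 1" "\<bar>a - 1\<bar> < e / cmod w" "K > 0"
      "\<forall>z\<in>uhp. cmod (g (of_real a * z)) = K * cmod (g z)"
      by blast
    have "dist (of_real a * w) w = cmod (of_real (a - 1) * w)" by (simp add: dist_norm algebra_simps)
    also have "\<dots> = \<bar>a - 1\<bar> * cmod w" by (simp only: norm_mult norm_of_real)
    also have "\<dots> < e" using t(3) nzu[OF w] by (simp add: field_simps)
    finally show "\<exists>x'\<in>V. x' \<noteq> w \<and> dist x' w < e"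
      using V[OF t(1,4,5)] t(2) nzu[OF w] by (intro bexI[of _ "of_real a * w"]) auto
  qed
  have "w islimpt {w. g w = 0}" if w: "w \<in> uhp" "g w = 0" for w
    using w by (intro acc) auto
  with nicely_meromorphic_zero_or_nonvanishing[OF g] False
  have hol: "g holomorphic_on uhp" and nz: "\<And>z. z \<in> uhp \<Longrightarrow> g z \<noteq> 0" by blast+
  define h where "h z = z * (deriv g z / g z)" for z
  have h: "h holomorphic_on uhp"
    unfolding h_def using nz by (intro holomorphic_intros hol open_uhp) auto
  have "w islimpt {v \<in> uhp. h v = h w}" if w: "w \<in> uhp" for w
  proof (rule acc[OF w], safe)
    fix a K :: real assume a: "a > 0" "K > 0" "\<forall>z\<in>uhp. cmod (g (of_real a * z)) = K * cmod (g z)"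
    show "0 < Im (of_real a * w)" using a w by simp
    have "of_real a * (deriv g (of_real a * w) / g (of_real a * w)) = 0 / of_real K + deriv g w / g w"
      using a w by (intro logderiv_transform[OF hol nz, of "\<lambda>z. of_real a * z" "\<lambda>_. of_real a"])
        (auto intro!: derivative_eq_intros)
    from arg_cong[OF this, of "\<lambda>x. w * x"] show "h (of_real a * w) = h w"
      by (simp add: h_def mult_ac)
  qed
  then obtain s where s: "\<And>z. z \<in> uhp \<Longrightarrow> h z = s"
    using constant_if_level_sets_accumulate[OF h] by blast
  have inv: "- of_real b / z \<in> uhp" if "z \<in> uhp" for z
    using b that nzu[OF that] by (auto simp: Im_divide complex_neq_0 intro!: divide_pos_pos mult_pos_pos)
  have "s = - of_real k / 2"
  proof -
    \<comment> \<open>Only the modulus of the factor is prescribed; the principal branch provides a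
      factor that is holomorphic on the half-plane.\<close>
    have u: "((\<lambda>z. of_real K * z powr of_real k) has_field_derivative
        of_real K * (of_real k * z powr (of_real k - 1))) (at z)" if "z \<in> uhp" for z
      using npos[OF that] by (auto intro!: derivative_eq_intros)
    have p: "((\<lambda>z. - of_real b / z) has_field_derivative of_real b / z^2) (at z)" if "z \<in> uhp" for z
      using nzu[OF that] by (auto intro!: derivative_eq_intros simp: power2_eq_square)
    \<comment> \<open>Since \<open>h\<close> is constant, evaluating at the single point
      \<open>\<i>\<close> determines \<open>s\<close>.\<close>
    have e: "(of_real b / \<i>^2) * (deriv g (- of_real b / \<i>) / g (- of_real b / \<i>)) =
        (of_real K * (of_real k * \<i> powr (of_real k - 1))) / (of_real K * \<i> powr of_real k) + deriv g \<i> / g \<i>"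
      using K I nzu by (intro logderiv_transform[OF hol nz p inv u])
        (auto simp: norm_mult norm_powr_of_real)
    have "(of_real K * (of_real k * \<i> powr (of_real k - 1))) / (of_real K * \<i> powr of_real k) = of_real k / \<i>"
      using K by (simp add: powr_diff)
    \<comment> \<open>Multiplication by \<open>\<i>\<close> turns both logarithmic derivatives into
      values of \<open>h\<close>; the derivative of the inversion supplies the minus sign.\<close>
    hence "- h (- of_real b / \<i>) = of_real k + h \<i>"
      using arg_cong[OF e, of "\<lambda>x. \<i> * x"] b by (simp add: h_def field_simps power2_eq_square)
    hence "- s = of_real k + s" using s inv[of \<i>] by simp
    hence "2 * s = - of_real k" by (simp add: algebra_simps minus_equation_iff add_eq_0_iff)
    hence "2 * s / 2 = - of_real k / 2" by (rule arg_cong)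
    thus ?thesis by simp
  qed
  \<comment> \<open>The equation \<open>z * g'/g = - k / 2\<close> is solved with the integrating
    factor \<open>z powr (k / 2)\<close>.\<close>
  have "\<exists>c. \<forall>z\<in>uhp. g z * z powr of_real (k / 2) = c"
  proof (rule has_field_derivative_zero_constant)
    show "convex uhp" by (rule convex_halfspace_Im_gt)
    fix z assume z: "z \<in> uhp"
    have "z * (deriv g z / g z) = - of_real k / 2" using s[OF z] \<open>s = _\<close> by (simp add: h_def)
    hence d: "deriv g z = - of_real (k / 2) * g z / z" using nz[OF z] nzu[OF z] by (simp add: field_simps)
    have "((\<lambda>z. g z * z powr of_real (k / 2)) has_field_derivative
        deriv g z * z powr of_real (k / 2) + of_real (k / 2) * z powr (of_real (k / 2) - 1) * g z) (at z)"
      using DERIV_mult[OF holomorphic_derivI[OF hol open_uhp z]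
          has_field_derivative_powr[OF npos[OF z], of "of_real (k/2)"]] by simp
    also have "deriv g z * z powr of_real (k / 2) + of_real (k / 2) * z powr (of_real (k / 2) - 1) * g z = 0"
      using nzu[OF z] by (simp add: d powr_diff)
    finally show "((\<lambda>z. g z * z powr of_real (k / 2)) has_field_derivative 0) (at z within uhp)"
      by (rule has_field_derivative_at_within)
  qed
  then obtain c where c: "\<And>z. z \<in> uhp \<Longrightarrow> g z * z powr of_real (k / 2) = c" by blast
  show ?thesis
  proof (rule that[of c])
    fix z assume "z \<in> uhp"
    thus "g z = c * z powr of_real (- k / 2)"
      using c[of z] nzu[of z] by (simp add: powr_minus field_simps)
  qed
qed

section \<open>Matrices and their action\<close>

definition mat2 :: "real \<Rightarrow> real \<Rightarrow> real \<Rightarrow> real \<Rightarrow> real^2^2" where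
  "mat2 a b c d = vector [vector [a, b], vector [c, d]]"

lemma mat2_nth [simp]:
  "mat2 a b c d $ 1 $ 1 = a" "mat2 a b c d $ 1 $ 2 = b"
  "mat2 a b c d $ 2 $ 1 = c" "mat2 a b c d $ 2 $ 2 = d"
  by (simp_all add: mat2_def)

lemma mat_one_nth [simp]:
  "(mat 1 :: real^2^2) $ 1 $ 1 = 1" "(mat 1 :: real^2^2) $ 1 $ 2 = 0"
  "(mat 1 :: real^2^2) $ 2 $ 1 = 0" "(mat 1 :: real^2^2) $ 2 $ 2 = 1"
  by (simp_all add: mat_def)

lemma matrix2_eq_iff:
  fixes A B :: "real^2^2"
  shows "A = B \<longleftrightarrow> A$1$1 = B$1$1 \<and> A$1$2 = B$1$2 \<and> A$2$1 = B$2$1 \<and> A$2$2 = B$2$2"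
  by (simp add: vec_eq_iff forall_2)

lemma matrix2_mult_nth:
  fixes A B :: "real^2^2"
  shows "(A ** B) $ i $ j = A $ i $ 1 * B $ 1 $ j + A $ i $ 2 * B $ 2 $ j"
  by (simp add: matrix_matrix_mult_def sum_2)

section \<open>Inverses and the cocycle relation\<close>

text \<open>The adjugate, which is the inverse on \<open>SL2\<close>. Its entries are polynomial, so
  its identities reduce to algebra.\<close>

definition adj2 :: "real^2^2 \<Rightarrow> real^2^2" where
  "adj2 A = mat2 (A$2$2) (- (A$1$2)) (- (A$2$1)) (A$1$1)"

lemma adj2_SL2: "A \<in> carrier SL2 \<Longrightarrow> adj2 A \<in> carrier SL2"
  by (simp add: carrier_SL2 adj2_def algebra_simps)

lemma adj2_mult: "A \<in> carrier SL2 \<Longrightarrow> adj2 A ** A = mat 1" "A \<in> carrier SL2 \<Longrightarrow> A ** adj2 A = mat 1"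
  by (simp_all add: carrier_SL2 matrix2_eq_iff matrix2_mult_nth adj2_def algebra_simps)

lemma adj2_mult_rev: "adj2 (A ** B) = adj2 B ** adj2 A"
  by (simp add: adj2_def matrix2_eq_iff matrix2_mult_nth)

lemma adj2_adj2 [simp]: "adj2 (adj2 A) = A"
  by (simp add: adj2_def matrix2_eq_iff)

lemma mult_SL2: "A \<in> carrier SL2 \<Longrightarrow> B \<in> carrier SL2 \<Longrightarrow> A ** B \<in> carrier SL2"
  by (simp add: SL2_def det_mul)

lemma mat_one_SL2: "mat 1 \<in> carrier SL2"
  by (simp add: carrier_SL2)

text \<open>The second equation lets the action and the automorphy factor of a conjugate be computed
  along two factorisations of one matrix.\<close>

lemma conj_SL2:
  assumes "L \<in> carrier SL2" "A \<in> carrier SL2"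
  shows "adj2 L ** A ** L \<in> carrier SL2" "L ** (adj2 L ** A ** L) = A ** L"
  using assms by (auto intro!: mult_SL2 adj2_SL2 simp: matrix_mul_assoc adj2_mult matrix_mul_lid)

lemma aut_factor_mult:
  assumes "A \<in> carrier SL2" "B \<in> carrier SL2" "z \<in> uhp"
  shows "aut_factor (A ** B) z = aut_factor A (moebius_map B z) * aut_factor B z"
proof -
  have nz: "aut_factor B z \<noteq> 0" by (rule aut_factor_nonzero[OF assms(2,3)])
  have "aut_factor A (moebius_map B z) * aut_factor B z
      = of_real (A$2$1) * (moebius_map B z * aut_factor B z) + of_real (A$2$2) * aut_factor B z"
    by (simp add: aut_factor_def[of A] algebra_simps)
  also have "moebius_map B z * aut_factor B z = of_real (B $ 1 $ 1) * z + of_real (B $ 1 $ 2)"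
    using nz by (simp add: moebius_map_def)
  finally show ?thesis by (simp add: aut_factor_def matrix2_mult_nth algebra_simps)
qed

lemma moebius_map_mult:
  assumes "A \<in> carrier SL2" "B \<in> carrier SL2" "z \<in> uhp"
  shows "moebius_map (A ** B) z = moebius_map A (moebius_map B z)"
proof -
  have nz: "aut_factor B z \<noteq> 0" by (rule aut_factor_nonzero[OF assms(2,3)])
  have e: "moebius_map B z * aut_factor B z = of_real (B $ 1 $ 1) * z + of_real (B $ 1 $ 2)"
    using nz by (simp add: moebius_map_def)
  have "moebius_map A (moebius_map B z) = (of_real (A$1$1) * (moebius_map B z * aut_factor B z)
      + of_real (A$1$2) * aut_factor B z) / (aut_factor A (moebius_map B z) * aut_factor B z)"
    using nz by (simp add: moebius_map_def[of A] divide_simps) (simp add: algebra_simps)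
  also have "\<dots> = moebius_map (A ** B) z"
    unfolding aut_factor_mult[OF assms, symmetric] e
    by (simp add: moebius_map_def matrix2_mult_nth aut_factor_def algebra_simps)
  finally show ?thesis ..
qed

lemma moebius_map_adj2:
  assumes "A \<in> carrier SL2" "z \<in> uhp"
  shows "moebius_map A (moebius_map (adj2 A) z) = z"
  using moebius_map_mult[OF assms(1) adj2_SL2[OF assms(1)] assms(2)]
  by (simp add: adj2_mult assms moebius_map_def aut_factor_def)

section \<open>The action on the sphere\<close>

definition hcoords :: "complex option \<Rightarrow> complex \<times> complex" where
  "hcoords p = (case p of None \<Rightarrow> (1, 0) | Some z \<Rightarrow> (z, 1))"

text \<open>In homogeneous coordinates, the case distinctions of \<^const>\<open>sphere_act\<close> disappear.\<close>

lemma sphere_act_iff: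
  assumes "A \<in> carrier SL2"
  shows "sphere_act A p = q \<longleftrightarrow> (\<exists>m. m \<noteq> 0 \<and>
    of_real (A$1$1) * fst (hcoords p) + of_real (A$1$2) * snd (hcoords p) = m * fst (hcoords q) \<and>
    of_real (A$2$1) * fst (hcoords p) + of_real (A$2$2) * snd (hcoords p) = m * snd (hcoords q))"
proof -
  have det: "A $ 1 $ 1 * A $ 2 $ 2 - A $ 1 $ 2 * A $ 2 $ 1 = 1" using assms by (simp add: carrier_SL2)
  hence detc: "complex_of_real (A $ 1 $ 1) * of_real (A $ 2 $ 2) - of_real (A $ 1 $ 2) * of_real (A $ 2 $ 1) = 1"
    by (metis of_real_1 of_real_diff of_real_mult)
  show ?thesis
  proof (cases p)
    case None
    thus ?thesis using det by (cases q) (auto simp: hcoords_def sphere_act_def divide_simps)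
  next
    case (Some z)
    have "of_real (A$1$1) * z + of_real (A$1$2) \<noteq> 0" if "aut_factor A z = 0"
    proof
      assume "of_real (A$1$1) * z + of_real (A$1$2) = 0"
      hence "(complex_of_real (A $ 1 $ 1) * of_real (A $ 2 $ 2) - of_real (A $ 1 $ 2) * of_real (A $ 2 $ 1)) = 0"
        using that unfolding aut_factor_def by algebra
      thus False using detc by simp
    qed
    thus ?thesis using Some by (cases q)
      (auto simp: hcoords_def sphere_act_def moebius_map_def aut_factor_def divide_simps)
  qed
qed

text \<open>The scalar belonging to the product is the product \<open>m * n\<close> of the scalars
  of the two factors.\<close>

lemma sphere_act_mult:
  assumes "A \<in> carrier SL2" "B \<in> carrier SL2"
  shows "sphere_act (A ** B) p = sphere_act A (sphere_act B p)"
proof -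
  define q where "q = sphere_act B p"
  define r where "r = sphere_act A q"
  obtain m where m: "m \<noteq> 0"
    "of_real (B$1$1) * fst (hcoords p) + of_real (B$1$2) * snd (hcoords p) = m * fst (hcoords q)"
    "of_real (B$2$1) * fst (hcoords p) + of_real (B$2$2) * snd (hcoords p) = m * snd (hcoords q)"
    using sphere_act_iff[OF assms(2), of p q] q_def by auto
  obtain n where n: "n \<noteq> 0"
    "of_real (A$1$1) * fst (hcoords q) + of_real (A$1$2) * snd (hcoords q) = n * fst (hcoords r)"
    "of_real (A$2$1) * fst (hcoords q) + of_real (A$2$2) * snd (hcoords q) = n * snd (hcoords r)"
    using sphere_act_iff[OF assms(1), of q r] r_def by auto
  have "sphere_act (A ** B) p = r"
    unfolding sphere_act_iff[OF mult_SL2[OF assms]]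
  proof (intro exI[of _ "m * n"] conjI)
    show "m * n \<noteq> 0" using m n by simp
    have "of_real ((A ** B)$1$1) * fst (hcoords p) + of_real ((A ** B)$1$2) * snd (hcoords p) =
      of_real (A$1$1) * (of_real (B$1$1) * fst (hcoords p) + of_real (B$1$2) * snd (hcoords p))
      + of_real (A$1$2) * (of_real (B$2$1) * fst (hcoords p) + of_real (B$2$2) * snd (hcoords p))"
      by (simp add: matrix2_mult_nth algebra_simps)
    also have "\<dots> = m * (of_real (A$1$1) * fst (hcoords q) + of_real (A$1$2) * snd (hcoords q))"
      unfolding m by (simp add: algebra_simps)
    finally show "of_real ((A ** B)$1$1) * fst (hcoords p) + of_real ((A ** B)$1$2) * snd (hcoords p) = m * n * fst (hcoords r)"
      unfolding n by simp
    have "of_real ((A ** B)$2$1) * fst (hcoords p) + of_real ((A ** B)$2$2) * snd (hcoords p) =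
      of_real (A$2$1) * (of_real (B$1$1) * fst (hcoords p) + of_real (B$1$2) * snd (hcoords p))
      + of_real (A$2$2) * (of_real (B$2$1) * fst (hcoords p) + of_real (B$2$2) * snd (hcoords p))"
      by (simp add: matrix2_mult_nth algebra_simps)
    also have "\<dots> = m * (of_real (A$2$1) * fst (hcoords q) + of_real (A$2$2) * snd (hcoords q))"
      unfolding m by (simp add: algebra_simps)
    finally show "of_real ((A ** B)$2$1) * fst (hcoords p) + of_real ((A ** B)$2$2) * snd (hcoords p) = m * n * snd (hcoords r)"
      unfolding n by simp
  qed
  thus ?thesis by (simp add: q_def r_def)
qed

lemma sphere_act_one: "sphere_act (mat 1) p = p"
  by (cases p) (auto simp: sphere_act_def aut_factor_def moebius_map_def)

lemma sphere_act_inj: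
  assumes "A \<in> carrier SL2" "sphere_act A p = sphere_act A q"
  shows "p = q"
  using arg_cong[OF assms(2), of "sphere_act (adj2 A)"]
  by (simp add: sphere_act_mult[symmetric] adj2_SL2 assms(1) adj2_mult sphere_act_one)

lemma sphere_act_conj:
  assumes "A \<in> carrier SL2" "L \<in> carrier SL2"
  shows "sphere_act (adj2 L ** A ** L) p = q \<longleftrightarrow> sphere_act A (sphere_act L p) = sphere_act L q"
proof -
  have "sphere_act L (sphere_act (adj2 L ** A ** L) p) = sphere_act A (sphere_act L p)"
    using conj_SL2[OF assms(2,1)] assms by (metis sphere_act_mult)
  thus ?thesis using sphere_act_inj[OF assms(2)] by metis
qed

section \<open>Fixed points as roots of a real quadratic form\<close>

text \<open>A vector is proportional to its image when a determinant vanishes; this determinant is a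
  binary quadratic form with real coefficients.\<close>

lemma fixes_iff:
  assumes "A \<in> carrier SL2"
  shows "sphere_act A p = p \<longleftrightarrow> (let x = fst (hcoords p); y = snd (hcoords p) in
    of_real (A$2$1) * x^2 + of_real (A$2$2 - A$1$1) * (x * y) - of_real (A$1$2) * y^2 = 0)"
proof (cases p)
  case None
  thus ?thesis by (auto simp: sphere_act_def hcoords_def)
next
  case (Some z)
  \<comment> \<open>The form equals \<open>z\<close> times the automorphy factor minus the numerator
    of the Moebius map. If the factor vanished, so would the numerator, and the determinant would be
    0.\<close>
  have "aut_factor A z \<noteq> 0" if "of_real (A$2$1) * z^2 + of_real (A$2$2 - A$1$1) * z - of_real (A$1$2) = 0"
  proof
    assume a: "aut_factor A z = 0"
    have "complex_of_real (A $ 1 $ 1) * of_real (A $ 2 $ 2) - of_real (A $ 1 $ 2) * of_real (A $ 2 $ 1) = 1"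
      using assms unfolding carrier_SL2 by (metis of_real_1 of_real_diff of_real_mult)
    moreover have "complex_of_real (A $ 1 $ 1) * of_real (A $ 2 $ 2) - of_real (A $ 1 $ 2) * of_real (A $ 2 $ 1) = 0"
      using that a unfolding aut_factor_def of_real_diff by algebra
    ultimately show False by simp
  qed
  moreover have "moebius_map A z = z \<longleftrightarrow> of_real (A$2$1) * z^2 + of_real (A$2$2 - A$1$1) * z - of_real (A$1$2) = 0"
    if "aut_factor A z \<noteq> 0"
    using that by (auto simp: moebius_map_def aut_factor_def divide_simps power2_eq_square algebra_simps)
  ultimately show ?thesis using Some by (auto simp: sphere_act_def hcoords_def Let_def)
qed

text \<open>A binary quadratic form with three projective roots is zero, so the matrix is scalar and
  its determinant leaves only the two signs.\<close>

lemma fixes_three_imp_trivial: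
  assumes A: "A \<in> carrier SL2" and "p \<noteq> q" "p \<noteq> r" "q \<noteq> r"
    and "sphere_act A p = p" "sphere_act A q = q" "sphere_act A r = r"
  shows "A = mat 1 \<or> A = - mat 1"
proof -
  define c e b where "c = complex_of_real (A$2$1)" "e = complex_of_real (A$2$2 - A$1$1)" "b = complex_of_real (A$1$2)"
  have *: "c * (fst (hcoords s))^2 + e * (fst (hcoords s) * snd (hcoords s)) - b * (snd (hcoords s))^2 = 0" if "s \<in> {p,q,r}" for s
    using that assms fixes_iff[OF A, of s] by (auto simp: Let_def c_e_b_def)
  have fin: "c = 0 \<and> e = 0 \<and> b = 0" if "x \<noteq> y" "x \<noteq> z" "y \<noteq> z"
     "c * x^2 + e * x - b = 0" "c * y^2 + e * y - b = 0" "c * z^2 + e * z - b = 0" for x y z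
  proof -
    have "(x - y) * (c * (x + y) + e) = 0" "(x - z) * (c * (x + z) + e) = 0" using that(4-6) by algebra+
    hence "c * (x + y) + e = 0" "c * (x + z) + e = 0" using that by auto
    moreover from this have "c * (y - z) = 0" by algebra
    ultimately show ?thesis using that by auto
  qed
  \<comment> \<open>This is the case where one of the three points is infinity, which contributes
    \<open>c = 0\<close>.\<close>
  have inf: "c = 0 \<and> e = 0 \<and> b = 0" if "x \<noteq> y" "c * x^2 + e * x - b = 0" "c * y^2 + e * y - b = 0" "c = 0" for x y
  proof -
    have "e * x = b" "e * y = b" using that by auto
    hence "e * (x - y) = 0" by (simp add: algebra_simps)
    thus ?thesis using that by auto
  qed
  have "c = 0 \<and> e = 0 \<and> b = 0"
    using *[of p] *[of q] *[of r] assms(2-4)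
    by (cases p; cases q; cases r) (auto simp: hcoords_def intro: fin inf dest: fin inf)
  hence "A$2$1 = 0" "A$2$2 = A$1$1" "A$1$2 = 0" by (auto simp: c_e_b_def)
  moreover from this have "A$1$1 * A$1$1 = 1" using A by (simp add: carrier_SL2)
  hence "A$1$1 = 1 \<or> A$1$1 = -1" by (simp add: square_eq_1_iff)
  ultimately show ?thesis by (auto simp: matrix2_eq_iff)
qed

text \<open>A real form with root \<open>z\<close> also has the conjugate root, so its coefficients
  are those of \<open>A$2$1\<close> times the product of the two linear factors.\<close>

lemma fixes_nonreal_form:
  assumes A: "A \<in> carrier SL2" and z: "Im z \<noteq> 0" and f: "sphere_act A (Some z) = Some z"
  shows "A$1$2 = - A$2$1 * (cmod z)^2" "A$2$2 - A$1$1 = - 2 * Re z * A$2$1"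
proof -
  have e: "of_real (A$2$1) * z^2 + of_real (A$2$2 - A$1$1) * z - of_real (A$1$2) = 0"
    using f fixes_iff[OF A] by (simp add: hcoords_def)
  have "Im z * (A$2$2 - A$1$1 + 2 * Re z * A$2$1) = 0"
    using arg_cong[OF e, of Im] by (simp add: power2_eq_square algebra_simps)
  thus 1: "A$2$2 - A$1$1 = - 2 * Re z * A$2$1" using z by simp
  have "A$2$1 * ((Re z)^2 - (Im z)^2) + (A$2$2 - A$1$1) * Re z - A$1$2 = 0"
    using arg_cong[OF e, of Re] by (simp add: power2_eq_square algebra_simps)
  thus "A$1$2 = - A$2$1 * (cmod z)^2" unfolding 1 cmod_power2 by algebra
qed

text \<open>Both matrices are combinations of the identity and one matrix depending only on
  \<open>z\<close>, so they lie in a commutative algebra.\<close>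

lemma fixes_nonreal_imp_commute:
  assumes "A \<in> carrier SL2" "B \<in> carrier SL2" "Im z \<noteq> 0"
    "sphere_act A (Some z) = Some z" "sphere_act B (Some z) = Some z"
  shows "A ** B = B ** A"
proof -
  note a = fixes_nonreal_form[OF assms(1,3,4)] and b = fixes_nonreal_form[OF assms(2,3,5)]
  have a2: "A$2$2 = A$1$1 - 2 * Re z * A$2$1" and b2: "B$2$2 = B$1$1 - 2 * Re z * B$2$1"
    using a b by linarith+
  show ?thesis by (simp add: matrix2_eq_iff matrix2_mult_nth a(1) b(1) a2 b2 algebra_simps)
qed

text \<open>When \<open>A$2$1\<close> is nonzero, the coefficients of the form determine the real
  part and the modulus of a nonreal root; when it is zero, \<open>A\<close> is the identity up to
  sign.\<close>

lemma fixes_nonreal_unique: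
  assumes A: "A \<in> carrier SL2" and z: "Im z > 0" "sphere_act A (Some z) = Some z"
    and w: "Im w > 0" "sphere_act A (Some w) = Some w" and ne: "A \<noteq> mat 1" "A \<noteq> - mat 1"
  shows "z = w"
proof -
  note a = fixes_nonreal_form[OF A _ z(2)] and b = fixes_nonreal_form[OF A _ w(2)]
  have c: "A$2$1 \<noteq> 0"
  proof
    assume c: "A$2$1 = 0"
    hence "A$1$2 = 0" "A$2$2 = A$1$1" using a z by auto
    moreover from this have "A$1$1 * A$1$1 = 1" using A c by (simp add: carrier_SL2)
    hence "A$1$1 = 1 \<or> A$1$1 = -1" by (simp add: square_eq_1_iff)
    ultimately show False using ne c by (auto simp: matrix2_eq_iff)
  qed
  hence "(cmod z)^2 = (cmod w)^2" "Re z = Re w" using a b z w by auto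
  hence "(Im z)^2 = (Im w)^2" by (simp add: cmod_power2)
  hence "Im z = Im w" using z w by (simp add: power2_eq_iff)
  thus ?thesis using \<open>Re z = Re w\<close> by (simp add: complex_eq_iff)
qed

section \<open>Continuity of the action at the identity and transitivity on the boundary\<close>

text \<open>The determinant \<open>l A\<close> of the coordinate vectors of the image of
  \<open>p\<close> and of \<open>q\<close> vanishes if \<open>A\<close> sends \<open>p\<close> to
  \<open>q\<close>. It is continuous in \<open>A\<close> and nonzero at the identity.\<close>

lemma eventually_sphere_act_neq:
  assumes "p \<noteq> q"
  shows "eventually (\<lambda>A. A \<in> carrier SL2 \<longrightarrow> sphere_act A p \<noteq> q) (nhds (mat 1))"
proof -
  define l where "l A = (of_real (A$1$1) * fst (hcoords p) + of_real (A$1$2) * snd (hcoords p)) * snd (hcoords q)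
    - (of_real (A$2$1) * fst (hcoords p) + of_real (A$2$2) * snd (hcoords p)) * fst (hcoords q)" for A :: "real^2^2"
  have "l (mat 1) \<noteq> 0" using assms by (cases p; cases q) (auto simp: l_def hcoords_def)
  moreover have "isCont l (mat 1)" unfolding l_def by (intro continuous_intros)
  ultimately have "eventually (\<lambda>A. l A \<noteq> 0) (nhds (mat 1))"
    by (simp add: isCont_def tendsto_at_iff_tendsto_nhds tendsto_imp_eventually_ne)
  thus ?thesis
  proof eventually_elim
    case (elim A)
    thus ?case by (auto simp: sphere_act_iff l_def)
  qed
qed

text \<open>The columns of each witness are homogeneous coordinates of \<open>p\<close> and
  \<open>q\<close>, scaled to determinant 1.\<close>

lemma transitive_on_boundary_pairs:
  assumes "p \<in> Some ` \<real> \<union> {None}" "q \<in> Some ` \<real> \<union> {None}" "p \<noteq> q"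
  obtains L where "L \<in> carrier SL2" "sphere_act L None = p" "sphere_act L (Some 0) = q"
proof -
  consider y where "p = None" "q = Some (of_real y)" | x where "p = Some (of_real x)" "q = None"
    | x y where "p = Some (of_real x)" "q = Some (of_real y)" "x \<noteq> y"
    using assms by (auto elim!: Reals_cases)
  thus ?thesis
  proof cases
    case (1 y)
    thus ?thesis by (intro that[of "mat2 1 y 0 1"]) (auto simp: carrier_SL2 sphere_act_def aut_factor_def moebius_map_def)
  next
    case (2 x)
    thus ?thesis by (intro that[of "mat2 x (-1) 1 0"]) (auto simp: carrier_SL2 sphere_act_def aut_factor_def moebius_map_def)
  next
    case (3 x y)
    thus ?thesis
      by (intro that[of "mat2 (x / (x - y)) y (1 / (x - y)) 1"])
         (auto simp: carrier_SL2 sphere_act_def aut_factor_def moebius_map_def divide_simps)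
  qed
qed

section \<open>Preimages in $\mathrm{SL}_2(\mathbb{R})$ of subgroups\<close>

lemma to_PSL2_mult: "to_PSL2 A \<otimes>\<^bsub>PSL2\<^esub> to_PSL2 B = to_PSL2 (A ** B)"
  by (auto simp: PSL2_def FactGroup_def set_mult_def to_PSL2_eq SL2_def matrix_minus_mult)

lemma to_PSL2_one: "to_PSL2 (mat 1) = \<one>\<^bsub>PSL2\<^esub>"
  by (simp add: PSL2_def FactGroup_def to_PSL2_eq)

lemma to_PSL2_adj2:
  assumes "A \<in> carrier SL2"
  shows "to_PSL2 (adj2 A) = inv\<^bsub>PSL2\<^esub> (to_PSL2 A)"
proof -
  interpret group PSL2 by (rule group_PSL2)
  show ?thesis
    using assms adj2_SL2[OF assms]
    by (intro inv_equality[symmetric]) (auto simp: to_PSL2_mult adj2_mult to_PSL2_one carrier_PSL2)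
qed

lemma preimage_SL2: "A \<in> SL2_preimage \<Gamma> \<Longrightarrow> A \<in> carrier SL2"
  by (simp add: SL2_preimage_def)

context
  fixes \<Gamma> :: "(real^2^2) set set"
  assumes \<Gamma>: "subgroup \<Gamma> PSL2"
begin


lemma preimage_mult: "A \<in> SL2_preimage \<Gamma> \<Longrightarrow> B \<in> SL2_preimage \<Gamma> \<Longrightarrow> A ** B \<in> SL2_preimage \<Gamma>"
  using subgroup.m_closed[OF \<Gamma>, of "to_PSL2 A" "to_PSL2 B"]
  by (simp add: SL2_preimage_def mult_SL2 to_PSL2_mult)

lemma preimage_adj2: "A \<in> SL2_preimage \<Gamma> \<Longrightarrow> adj2 A \<in> SL2_preimage \<Gamma>"
  using subgroup.m_inv_closed[OF \<Gamma>, of "to_PSL2 A"]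
  by (simp add: SL2_preimage_def adj2_SL2 to_PSL2_adj2)

lemma preimage_one: "mat 1 \<in> SL2_preimage \<Gamma>"
  using subgroup.one_closed[OF \<Gamma>] by (simp add: SL2_preimage_def mat_one_SL2 to_PSL2_one)

lemma subgroup_eq_image_preimage: "\<Gamma> = to_PSL2 ` SL2_preimage \<Gamma>"
  using subgroup.subset[OF \<Gamma>] by (auto simp: SL2_preimage_def carrier_PSL2)

lemma noncommuting_preimage:
  assumes "\<not> comm_group (PSL2\<lparr>carrier := \<Gamma>\<rparr>)"
  obtains A B where "A \<in> SL2_preimage \<Gamma>" "B \<in> SL2_preimage \<Gamma>" "A ** B \<noteq> B ** A"
proof -
  have "group (PSL2\<lparr>carrier := \<Gamma>\<rparr>)"
    using subgroup.subgroup_is_group[OF \<Gamma> group_PSL2] .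
  with assms obtain x y where "x \<in> \<Gamma>" "y \<in> \<Gamma>" "x \<otimes>\<^bsub>PSL2\<^esub> y \<noteq> y \<otimes>\<^bsub>PSL2\<^esub> x"
    using group.group_comm_groupI[of "PSL2\<lparr>carrier := \<Gamma>\<rparr>"] by auto
  thus ?thesis
    using that subgroup_eq_image_preimage by (metis (no_types, lifting) imageE to_PSL2_mult)
qed

text \<open>If the identity were isolated in the preimage, translating its neighbourhood by group
  elements would isolate every element of \<Gamma>.\<close>

lemma one_islimpt_preimage:
  assumes "\<not> discrete_subgroup \<Gamma>"
  shows "mat 1 islimpt SL2_preimage \<Gamma>"
proof (rule ccontr)
  assume "\<not> mat 1 islimpt SL2_preimage \<Gamma>"
  then obtain T where T: "mat 1 \<in> T" "open T" "\<And>A. A \<in> SL2_preimage \<Gamma> \<Longrightarrow> A \<in> T \<Longrightarrow> A = mat 1"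
    unfolding islimpt_def by blast
  have "openin (subtopology PSL2_topology \<Gamma>) {\<gamma>}" if \<gamma>: "\<gamma> \<in> \<Gamma>" for \<gamma>
  proof -
    obtain B where B: "B \<in> SL2_preimage \<Gamma>" "\<gamma> = to_PSL2 B"
      using \<gamma> subgroup_eq_image_preimage by auto
    \<comment> \<open>Closing the translate of \<open>T\<close> under sign makes \<open>V\<close>
      the full preimage of \<open>U\<close> within \<open>SL2\<close>, so \<open>U\<close> is open
      in the quotient.\<close>
    define V where "V = {A. A ** adj2 B \<in> T} \<union> {A. - A ** adj2 B \<in> T}"
    define U where "U = to_PSL2 ` (carrier SL2 \<inter> V)"
    have c: "continuous_on UNIV (\<lambda>A. A ** adj2 B)" "continuous_on UNIV (\<lambda>A. - A ** adj2 B)"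
      unfolding matrix_matrix_mult_def by (intro continuous_intros)+
    have "open V"
      unfolding V_def using open_vimage[OF T(2) c(1)] open_vimage[OF T(2) c(2)]
      by (auto simp: vimage_def)
    moreover have neg: "- A \<in> V" if "A \<in> V" for A using that by (auto simp: V_def)
    have "{A \<in> carrier SL2. to_PSL2 A \<in> U} = carrier SL2 \<inter> V"
      using neg by (fastforce simp: U_def to_PSL2_eq doubleton_eq_iff)
    ultimately have "openin PSL2_topology U"
      by (auto simp: openin_PSL2_topology carrier_PSL2 U_def)
    moreover have "\<gamma> \<in> U"
      using B preimage_SL2[OF B(1)] T(1) by (auto simp: U_def V_def adj2_mult)
    moreover have "x = \<gamma>" if x: "x \<in> U" "x \<in> \<Gamma>" for x
    proof -
      obtain A where A: "A \<in> carrier SL2" "A \<in> V" "x = to_PSL2 A" "A \<in> SL2_preimage \<Gamma>"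
        using x unfolding U_def SL2_preimage_def by blast
      have "- A \<in> SL2_preimage \<Gamma>"
        using A by (simp add: SL2_preimage_def carrier_SL2 to_PSL2_eq insert_commute)
      hence "A ** adj2 B = mat 1 \<or> - A ** adj2 B = mat 1"
        using A B T(3) preimage_mult preimage_adj2 unfolding V_def by blast
      hence "A ** adj2 B ** B = B \<or> - A ** adj2 B ** B = B"
        by (auto simp: matrix_mul_lid)
      hence "A = B \<or> - A = B"
        using preimage_SL2[OF B(1)] by (simp add: adj2_mult matrix_mul_assoc[symmetric] matrix_mul_rid)
      thus "x = \<gamma>" using A B by (auto simp: to_PSL2_eq)
    qed
    ultimately have "openin PSL2_topology U \<and> {\<gamma>} = U \<inter> \<Gamma>" using \<gamma> by blast
    thus ?thesis unfolding openin_subtopology by blast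
  qed
  moreover have "topspace (subtopology PSL2_topology \<Gamma>) = \<Gamma>"
    using subgroup.subset[OF \<Gamma>] by (auto simp: topspace_PSL2)
  ultimately have "discrete_subgroup \<Gamma>"
    unfolding discrete_subgroup_def by (metis discrete_topology_unique)
  thus False using assms by blast
qed

lemma Inter_Fix: "(\<Inter>\<gamma>\<in>\<Gamma>. Fix \<gamma>) = {p. \<forall>A \<in> SL2_preimage \<Gamma>. sphere_act A p = p}"
  by (subst subgroup_eq_image_preimage) (auto simp: Fix_def PSL2_act_to_PSL2)

lemma finite_invariant_set:
  assumes "elementary \<Gamma>"
  obtains p Orb where "p \<in> Some ` (uhp \<union> \<real>) \<union> {None}" "finite Orb" "p \<in> Orb"
    "\<And>A q. A \<in> SL2_preimage \<Gamma> \<Longrightarrow> q \<in> Orb \<Longrightarrow> sphere_act A q \<in> Orb"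
proof -
  obtain p where p: "p \<in> Some ` (uhp \<union> \<real>) \<union> {None}" "finite (orbit (PSL2\<lparr>carrier := \<Gamma>\<rparr>) PSL2_act p)"
    using assms unfolding elementary_def by blast
  define Orb where "Orb = (\<lambda>A. sphere_act A p) ` SL2_preimage \<Gamma>"
  have "Orb \<subseteq> orbit (PSL2\<lparr>carrier := \<Gamma>\<rparr>) PSL2_act p"
    by (auto simp: Orb_def orbit_def SL2_preimage_def PSL2_act_to_PSL2[symmetric])
  hence "finite Orb" using p(2) finite_subset by blast
  moreover have "p \<in> Orb" using preimage_one by (force simp: Orb_def sphere_act_one)
  moreover have "sphere_act A q \<in> Orb" if "A \<in> SL2_preimage \<Gamma>" "q \<in> Orb" for A q
    using that preimage_mult preimage_SL2 by (auto simp: Orb_def sphere_act_mult[symmetric])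
  ultimately show ?thesis using p(1) by (intro that) auto
qed

end

section \<open>Automorphic forms\<close>

text \<open>Scaling keeps the value 0 at poles, which is also correct when \<open>c = 0\<close>
  removes them, so the identity holds at every point.\<close>

lemma mero_fun_scale: "mero_fun (mero_scale c f) z = c * mero_fun f z"
proof -
  have "mero_fun (Abs_mero (\<lambda>z. c * mero_fun f z)) = (\<lambda>z. c * mero_fun f z)"
    by (rule Abs_mero_inverse) (auto intro: nicely_mero_fun simp: mero_fun_outside)
  thus ?thesis unfolding mero_scale_def by (metis mero_of_mero_fun)
qed

lemma mero_ext: "(\<And>z. z \<in> uhp \<Longrightarrow> mero_fun f z = mero_fun g z) \<Longrightarrow> f = g"
  by (metis mero_fun_inject mero_fun_outside ext)

text \<open>Evaluating at the preimage of \<open>z\<close> under \<open>L\<close> suffices; slashing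
  with the inverse instead could leave a constant factor from the branch.\<close>

lemma slash_inj:
  assumes "L \<in> carrier SL2" "slash k L f = slash k L g"
  shows "f = g"
proof (rule mero_ext)
  fix z assume z: "z \<in> uhp"
  let ?w = "moebius_map (adj2 L) z"
  have w: "?w \<in> uhp" by (rule moebius_uhp[OF adj2_SL2[OF assms(1)] z])
  show "mero_fun f z = mero_fun g z"
    using arg_cong[OF assms(2), of "\<lambda>f. mero_fun f ?w"] aut_factor_nonzero[OF assms(1) w]
    by (simp only: mero_fun_slash[OF assms(1) w] moebius_map_adj2[OF assms(1) z]) auto
qed

section \<open>Transformation of the modulus\<close>

text \<open>With moduli the multiplier disappears, so conjugation by \<open>L\<close> requires no
  conjugated multiplier system.\<close>

definition cmod_automorphic :: "real \<Rightarrow> real^2^2 \<Rightarrow> (complex \<Rightarrow> complex) \<Rightarrow> bool" where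
  "cmod_automorphic k A g \<longleftrightarrow>
    (\<forall>z\<in>uhp. cmod (g (moebius_map A z)) = cmod (aut_factor A z) powr k * cmod (g z))"

lemma M_u_cmod_automorphic:
  assumes "multiplier_system \<Gamma> k \<nu>" "f \<in> M_u \<Gamma> k \<nu>" "A \<in> SL2_preimage \<Gamma>"
  shows "cmod_automorphic k A (mero_fun f)"
  unfolding cmod_automorphic_def
proof
  fix z assume z: "z \<in> uhp"
  have A: "A \<in> carrier SL2" using assms(3) by (rule preimage_SL2)
  have "cmod (\<nu> A) = 1" using assms(1,3) by (simp add: multiplier_system_def)
  moreover have "mero_fun (slash k A f) z = \<nu> A * mero_fun f z"
    using assms(2,3) by (simp add: M_u_def mero_fun_scale)
  hence "aut_factor A z powr of_real (- k) * mero_fun f (moebius_map A z) = \<nu> A * mero_fun f z"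
    by (simp only: mero_fun_slash[OF A z])
  from arg_cong[OF this, of cmod]
  have "cmod (aut_factor A z) powr (- k) * cmod (mero_fun f (moebius_map A z)) = cmod (\<nu> A) * cmod (mero_fun f z)"
    by (simp only: norm_mult norm_powr_of_real)
  ultimately show "cmod (mero_fun f (moebius_map A z)) = cmod (aut_factor A z) powr k * cmod (mero_fun f z)"
    using aut_factor_nonzero[OF A z] by (simp add: powr_minus field_simps)
qed

text \<open>For the conjugate \<open>B\<close> one has \<open>L ** B = A ** L\<close>. The cocycle
  relation on both sides matches the automorphy factors, and real powers of their moduli are
  multiplicative.\<close>

lemma cmod_automorphic_slash:
  assumes f: "cmod_automorphic k A (mero_fun f)" and A: "A \<in> carrier SL2" and L: "L \<in> carrier SL2"
  shows "cmod_automorphic k (adj2 L ** A ** L) (mero_fun (slash k L f))"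
  unfolding cmod_automorphic_def
proof
  fix z assume z: "z \<in> uhp"
  define B where "B = adj2 L ** A ** L"
  have B: "B \<in> carrier SL2" "L ** B = A ** L" using conj_SL2[OF L A] by (auto simp: B_def)
  note Bz = moebius_uhp[OF B(1) z] and Lz = moebius_uhp[OF L z]
  have m: "moebius_map L (moebius_map B z) = moebius_map A (moebius_map L z)"
    using moebius_map_mult[OF L B(1) z] moebius_map_mult[OF A L z] B by simp
  have "aut_factor L (moebius_map B z) * aut_factor B z = aut_factor A (moebius_map L z) * aut_factor L z"
    using aut_factor_mult[OF L B(1) z] aut_factor_mult[OF A L z] B by simp
  hence j: "cmod (aut_factor A (moebius_map L z)) powr k * cmod (aut_factor L z) powr k
     = cmod (aut_factor L (moebius_map B z)) powr k * cmod (aut_factor B z) powr k"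
    by (metis norm_mult powr_mult)
  have nz: "aut_factor L (moebius_map B z) \<noteq> 0" "aut_factor L z \<noteq> 0"
    using aut_factor_nonzero[OF L] Bz z by auto
  have s: "cmod (mero_fun (slash k L f) w) = cmod (aut_factor L w) powr (- k) * cmod (mero_fun f (moebius_map L w))"
    if "w \<in> uhp" for w
    by (simp only: mero_fun_slash[OF L that] norm_mult norm_powr_of_real)
  have "cmod (mero_fun f (moebius_map A (moebius_map L z)))
     = cmod (aut_factor A (moebius_map L z)) powr k * cmod (mero_fun f (moebius_map L z))"
    using f Lz unfolding cmod_automorphic_def by blast
  thus "cmod (mero_fun (slash k L f) (moebius_map (adj2 L ** A ** L) z))
     = cmod (aut_factor (adj2 L ** A ** L) z) powr k * cmod (mero_fun (slash k L f) z)"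
    unfolding B_def[symmetric] s[OF Bz] s[OF z] m using j nz
    by (simp add: powr_minus field_simps)
qed

section \<open>Groups with a common fixed point\<close>

lemma moebius_upper_triangular:
  assumes "A \<in> carrier SL2" "A$2$1 = 0"
  shows "moebius_map A z = of_real ((A$1$1)^2) * z + of_real (A$1$1 * A$1$2)"
    "aut_factor A z = of_real (A$2$2)" "A$2$2 = 1 / A$1$1" "A$1$1 \<noteq> 0"
proof -
  have d: "A$1$1 * A$2$2 = 1" using assms by (simp add: carrier_SL2)
  thus "A$1$1 \<noteq> 0" by auto
  with d show e: "A$2$2 = 1 / A$1$1" by (simp add: field_simps)
  show "aut_factor A z = of_real (A$2$2)" by (simp add: aut_factor_def assms)
  show "moebius_map A z = of_real ((A$1$1)^2) * z + of_real (A$1$1 * A$1$2)"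
    using \<open>A$1$1 \<noteq> 0\<close> by (simp add: moebius_map_def aut_factor_def assms e power2_eq_square algebra_simps)
qed

text \<open>The commutator of two non-commuting triangular matrices is a translation, and conjugating it
  repeatedly by a contraction produces arbitrarily small translations.\<close>

lemma triangular_group_small_translations:
  assumes S: "S \<subseteq> carrier SL2" and m: "\<And>A B. A \<in> S \<Longrightarrow> B \<in> S \<Longrightarrow> A ** B \<in> S"
    and i: "\<And>A. A \<in> S \<Longrightarrow> adj2 A \<in> S" and t: "\<And>A. A \<in> S \<Longrightarrow> A$2$1 = 0"
    and AB: "A \<in> S" "B \<in> S" "A ** B \<noteq> B ** A"
  obtains D where "D \<in> S" "(D$1$1)^2 < 1"
    "\<And>e. e > 0 \<Longrightarrow> \<exists>t. t \<noteq> 0 \<and> \<bar>t\<bar> < e \<and> mat2 1 t 0 1 \<in> S"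
proof -
  have diag: "X$2$2 = 1 / X$1$1" "X$1$1 \<noteq> 0" "X$2$1 = 0" if "X \<in> S" for X
    using moebius_upper_triangular[of X] t[OF that] S that by auto
  note d = diag[OF AB(1)] diag[OF AB(2)]
  have ne: "A$1$1 * B$1$2 + A$1$2 * B$2$2 \<noteq> B$1$1 * A$1$2 + B$1$2 * A$2$2"
    using AB(3) d by (auto simp: matrix2_eq_iff matrix2_mult_nth mult.commute)
  \<comment> \<open>The upper right entry of the commutator of \<open>A\<close> and
    \<open>B\<close>, nonzero because they do not commute.\<close>
  define s where "s = A$1$1 * B$1$1 * (A$1$1 * B$1$2 + A$1$2 * B$2$2 - (B$1$1 * A$1$2 + B$1$2 * A$2$2))"
  have s: "s \<noteq> 0" using ne d by (simp add: s_def)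
  have "(A ** B) ** adj2 (B ** A) = mat2 1 s 0 1"
    using d by (simp add: matrix2_eq_iff matrix2_mult_nth adj2_def s_def) (simp add: algebra_simps)
  hence sS: "mat2 1 s 0 1 \<in> S" using m i AB by metis
  \<comment> \<open>Otherwise both are translations up to sign and commute.\<close>
  have "(A$1$1)^2 \<noteq> 1 \<or> (B$1$1)^2 \<noteq> 1"
  proof (rule ccontr)
    assume "\<not> ?thesis"
    hence "A$1$1 = 1 \<or> A$1$1 = -1" "B$1$1 = 1 \<or> B$1$1 = -1" by (auto simp: power2_eq_1_iff)
    thus False using ne d by auto
  qed
  then obtain E where E: "E \<in> S" "(E$1$1)^2 \<noteq> 1" using AB by blast
  \<comment> \<open>Either \<open>E\<close> or its inverse is a contraction.\<close>
  obtain D where D: "D \<in> S" "(D$1$1)^2 < 1"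
  proof (cases "(E$1$1)^2 < 1")
    case False
    hence "(adj2 E $1$1)^2 < 1"
      using E diag[OF E(1)] by (simp add: adj2_def power_divide)
    thus ?thesis using that i E by blast
  qed (use E that in blast)
  note dD = diag[OF D(1)]
  define q where "q = (D$1$1)^2"
  have q: "q > 0" "q < 1" using dD D by (auto simp: q_def)
  have pow: "mat2 1 (q ^ n * s) 0 1 \<in> S" for n
  proof (induction n)
    case (Suc n)
    have "D ** mat2 1 (q ^ n * s) 0 1 ** adj2 D = mat2 1 (q ^ Suc n * s) 0 1"
      using dD by (simp add: matrix2_eq_iff matrix2_mult_nth adj2_def q_def power2_eq_square)
        (simp add: algebra_simps)
    thus ?case using m i D Suc by metis
  qed (use sS in simp)
  show ?thesis
  proof (rule that[OF D])
    fix e :: real assume "e > 0"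
    hence "e / \<bar>s\<bar> > 0" using s by simp
    from real_arch_pow_inv[OF this q(2)] obtain n where "q ^ n < e / \<bar>s\<bar>" by blast
    thus "\<exists>t. t \<noteq> 0 \<and> \<bar>t\<bar> < e \<and> mat2 1 t 0 1 \<in> S"
      using pow[of n] q s by (intro exI[of _ "q ^ n * s"]) (auto simp: abs_mult field_simps)
  qed
qed

text \<open>After moving the fixed point to infinity, the group is triangular and non-commutative,
  and \<open>zero_if_small_translations\<close> applies to the conjugated form.\<close>

lemma M_u_zero_if_common_fixed_point:
  assumes \<Gamma>: "subgroup \<Gamma> PSL2" "\<not> comm_group (PSL2\<lparr>carrier := \<Gamma>\<rparr>)"
    and k: "k \<noteq> 0" and \<nu>: "multiplier_system \<Gamma> k \<nu>"
    and p: "\<And>A. A \<in> SL2_preimage \<Gamma> \<Longrightarrow> sphere_act A p = p"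
    and f: "f \<in> M_u \<Gamma> k \<nu>"
  shows "f = 0"
proof -
  obtain A B where AB: "A \<in> SL2_preimage \<Gamma>" "B \<in> SL2_preimage \<Gamma>" "A ** B \<noteq> B ** A"
    using noncommuting_preimage[OF \<Gamma>] .
  \<comment> \<open>The stabilizer of a nonreal point is commutative.\<close>
  have "p \<in> Some ` \<real> \<union> {None}"
  proof (rule ccontr)
    assume "\<not> ?thesis"
    then obtain z where "p = Some z" "Im z \<noteq> 0"
      by (cases p) (auto simp: complex_is_Real_iff inj_image_mem_iff)
    thus False using fixes_nonreal_imp_commute[of A B z] p AB preimage_SL2 by blast
  qed
  \<comment> \<open>The point \<open>q\<close> merely completes \<open>p\<close> to a boundary pair,
    so that some \<open>L\<close> sends infinity to \<open>p\<close>.\<close>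
  moreover obtain q where "q \<in> Some ` \<real> \<union> {None :: complex option}" "p \<noteq> q"
    by (cases p) (auto intro: that[of "Some 0"] that[of None])
  ultimately obtain L where L: "L \<in> carrier SL2" "sphere_act L None = p"
    using transitive_on_boundary_pairs by metis
  define S where "S = (\<lambda>A. adj2 L ** A ** L) ` SL2_preimage \<Gamma>"
  define g where "g = mero_fun (slash k L f)"
  have aut: "cmod_automorphic k X g" if "X \<in> S" for X
    using that cmod_automorphic_slash[OF M_u_cmod_automorphic[OF \<nu> f] preimage_SL2 L(1)]
    by (auto simp: S_def g_def)
  have conj: "(adj2 L ** X ** L) ** (adj2 L ** Y ** L) = adj2 L ** (X ** Y) ** L" for X Y
  proof -
    have "(adj2 L ** X ** L) ** (adj2 L ** Y ** L) = adj2 L ** X ** (L ** adj2 L) ** Y ** L"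
      by (simp add: matrix_mul_assoc)
    thus ?thesis by (simp add: adj2_mult L(1) matrix_mul_rid matrix_mul_assoc)
  qed
  have SL: "S \<subseteq> carrier SL2" using conj_SL2[OF L(1)] preimage_SL2 by (auto simp: S_def)
  have tri: "X$2$1 = 0" if X: "X \<in> S" for X
  proof -
    have "sphere_act X None = None"
      using X L p preimage_SL2 by (auto simp: S_def sphere_act_conj)
    thus ?thesis by (simp add: sphere_act_def split: if_splits)
  qed
  obtain D where D: "D \<in> S" "(D$1$1)^2 < 1"
    and T: "\<And>e. e > 0 \<Longrightarrow> \<exists>t. t \<noteq> 0 \<and> \<bar>t\<bar> < e \<and> mat2 1 t 0 1 \<in> S"
  proof (rule triangular_group_small_translations[OF SL _ _ tri, of "adj2 L ** A ** L" "adj2 L ** B ** L"])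
    show "X ** Y \<in> S" if "X \<in> S" "Y \<in> S" for X Y
      using that preimage_mult[OF \<Gamma>(1)] by (auto simp: S_def conj)
    show "adj2 X \<in> S" if "X \<in> S" for X
      using that preimage_adj2[OF \<Gamma>(1)] by (auto simp: S_def adj2_mult_rev matrix_mul_assoc)
    show "adj2 L ** A ** L ** (adj2 L ** B ** L) \<noteq> adj2 L ** B ** L ** (adj2 L ** A ** L)"
    proof
      assume "adj2 L ** A ** L ** (adj2 L ** B ** L) = adj2 L ** B ** L ** (adj2 L ** A ** L)"
      hence "L ** (adj2 L ** (A ** B) ** L) = L ** (adj2 L ** (B ** A) ** L)" by (simp add: conj)
      hence "A ** B ** L = B ** A ** L"
        using conj_SL2(2)[OF L(1)] AB preimage_SL2 mult_SL2 by metis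
      hence "A ** B ** L ** adj2 L = B ** A ** L ** adj2 L" by simp
      hence "A ** B ** (L ** adj2 L) = B ** A ** (L ** adj2 L)" by (simp add: matrix_mul_assoc)
      thus False using AB by (simp add: adj2_mult L(1) matrix_mul_rid)
    qed
  qed (use AB in \<open>auto simp: S_def\<close>)
  note mD = moebius_upper_triangular[OF subsetD[OF SL D(1)] tri[OF D(1)]]
  have "g z = 0" if z: "z \<in> uhp" for z
  proof (rule zero_if_small_translations[OF _ _ _ _ _ _ _ z])
    show "g nicely_meromorphic_on uhp" unfolding g_def by (rule nicely_mero_fun)
    show "(D$1$1)^2 > 0" "(D$1$1)^2 \<noteq> 1" using mD D by auto
    show "\<bar>D$2$2\<bar> powr k > 0" using mD by simp
    \<comment> \<open>The weight enters here: a nonzero power of a positive number other than 1 is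
      not 1.\<close>
    show "\<bar>D$2$2\<bar> powr k \<noteq> 1"
    proof
      assume "\<bar>D$2$2\<bar> powr k = 1"
      moreover have "\<bar>D$2$2\<bar> > 0" using mD by simp
      ultimately have "\<bar>D$2$2\<bar> = 1" using k powr_eq_one_iff_gen by metis
      hence "\<bar>D$1$1\<bar> = 1" using mD by (simp add: field_simps)
      thus False using D by (metis less_irrefl power2_abs power_one)
    qed
    show "cmod (g (of_real ((D$1$1)^2) * w + of_real (D$1$1 * D$1$2))) = \<bar>D$2$2\<bar> powr k * cmod (g w)"
      if "w \<in> uhp" for w
      using aut[OF D(1)] that unfolding cmod_automorphic_def mD(1,2) norm_of_real by blast
    fix e :: real assume "e > 0"
    from T[OF this] obtain t where t: "t \<noteq> 0" "\<bar>t\<bar> < e" "mat2 1 t 0 1 \<in> S" by blast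
    show "\<exists>t::real. t \<noteq> 0 \<and> \<bar>t\<bar> < e \<and> (\<forall>z\<in>uhp. cmod (g (z + of_real t)) = cmod (g z))"
      using aut[OF t(3)] t(1,2)
      by (intro exI[of _ t]) (auto simp: cmod_automorphic_def moebius_map_def aut_factor_def)
  qed
  hence "slash k L f = slash k L 0"
    using slash_scale[OF L(1), of k 0 0]
    by (intro mero_ext) (simp add: g_def, metis mero.scale_zero_left mero_fun_scale mult_zero_left)
  thus ?thesis by (rule slash_inj[OF L(1)])
qed

section \<open>Groups without a common fixed point\<close>

text \<open>Group elements near the identity fix a finite orbit pointwise. A nontrivial one has at
  most two fixed points, and at most one in the half-plane, so the orbit is a pair on the
  boundary.\<close>

lemma swapped_boundary_pair:
  assumes \<Gamma>: "subgroup \<Gamma> PSL2" "\<not> discrete_subgroup \<Gamma>" "elementary \<Gamma>"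
    and nf: "\<And>p. \<exists>A \<in> SL2_preimage \<Gamma>. sphere_act A p \<noteq> p"
  obtains p q A where "p \<in> Some ` \<real> \<union> {None}" "q \<in> Some ` \<real> \<union> {None}" "p \<noteq> q"
    "A \<in> SL2_preimage \<Gamma>" "sphere_act A p = q" "sphere_act A q = p"
    "\<exists>\<^sub>F B in at (mat 1). B \<in> SL2_preimage \<Gamma> \<and> sphere_act B p = p \<and> sphere_act B q = q \<and> B \<noteq> - mat 1"
proof -
  obtain p Orb where p: "p \<in> Some ` (uhp \<union> \<real>) \<union> {None}" "finite Orb" "p \<in> Orb"
    and Orb: "\<And>A q. A \<in> SL2_preimage \<Gamma> \<Longrightarrow> q \<in> Orb \<Longrightarrow> sphere_act A q \<in> Orb"
    using finite_invariant_set[OF \<Gamma>(1,3)] by metis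
  \<comment> \<open>Only finitely many pairs \<open>r\<close>, \<open>s\<close> occur, so one
    neighbourhood serves all; invariance of \<open>Orb\<close> then leaves each point fixed.\<close>
  have "\<forall>\<^sub>F B in at (mat 1). \<forall>r\<in>Orb. \<forall>s\<in>Orb. r \<noteq> s \<longrightarrow> B \<in> carrier SL2 \<longrightarrow> sphere_act B r \<noteq> s"
    using p(2) eventually_sphere_act_neq
    by (intro eventually_ball_finite ballI) (auto simp: eventually_nhds_conv_at intro: always_eventually)
  moreover have "mat 1 \<noteq> (- mat 1 :: real^2^2)" by (simp add: matrix2_eq_iff)
  hence "\<forall>\<^sub>F B in at (mat 1). B \<noteq> (- mat 1 :: real^2^2)"
    by (intro t1_space_nhds eventually_nhds_conv_at[THEN iffD1, THEN conjunct1])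
  moreover have "\<forall>\<^sub>F B in at (mat 1). B \<noteq> (mat 1 :: real^2^2)" by (simp add: eventually_at_filter)
  ultimately have "\<forall>\<^sub>F B in at (mat 1). B \<in> SL2_preimage \<Gamma> \<longrightarrow>
      B \<in> SL2_preimage \<Gamma> \<and> (\<forall>r\<in>Orb. sphere_act B r = r) \<and> B \<noteq> - mat 1 \<and> B \<noteq> mat 1"
    by eventually_elim (use Orb preimage_SL2 in metis)
  moreover have "\<exists>\<^sub>F B in at (mat 1). B \<in> SL2_preimage \<Gamma>"
    using one_islimpt_preimage[OF \<Gamma>(1,2)] by (simp add: islimpt_conv_frequently_at)
  ultimately have near: "\<exists>\<^sub>F B in at (mat 1).
      B \<in> SL2_preimage \<Gamma> \<and> (\<forall>r\<in>Orb. sphere_act B r = r) \<and> B \<noteq> - mat 1 \<and> B \<noteq> mat 1"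
    by (rule frequently_rev_mp[rotated])
  then obtain B where B: "B \<in> SL2_preimage \<Gamma>" "\<And>r. r \<in> Orb \<Longrightarrow> sphere_act B r = r" "B \<noteq> - mat 1" "B \<noteq> mat 1"
    by (auto dest: frequently_ex)
  obtain A where A: "A \<in> SL2_preimage \<Gamma>" "sphere_act A p \<noteq> p" using nf by blast
  define q where "q = sphere_act A p"
  have q: "q \<in> Orb" "q \<noteq> p" using A Orb p by (auto simp: q_def)
  have Oeq: "r = p \<or> r = q" if "r \<in> Orb" for r
    using fixes_three_imp_trivial[OF preimage_SL2[OF B(1)], of p q r] B p q that by metis
  have AS: "A \<in> carrier SL2" using A(1) by (rule preimage_SL2)
  \<comment> \<open>Since \<open>A\<close> already sends \<open>p\<close> to \<open>q\<close>,
    injectivity prevents it from fixing \<open>q\<close>; it must swap the two points.\<close>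
  have "sphere_act A q \<noteq> q"
    using sphere_act_inj[OF AS, of q p] q by (auto simp: q_def)
  hence Aq: "sphere_act A q = p" using Oeq Orb[OF A(1) q(1)] by blast
  \<comment> \<open>If \<open>p\<close> were in the half-plane, so would \<open>q\<close> be, and
    \<open>B\<close> would have two fixed points there.\<close>
  have pb: "p \<in> Some ` \<real> \<union> {None}"
  proof (rule ccontr)
    assume "\<not> ?thesis"
    then obtain z where z: "p = Some z" "z \<in> uhp" using p by auto
    hence "q = Some (moebius_map A z)" using aut_factor_nonzero[OF AS z(2)] by (simp add: q_def sphere_act_def)
    thus False using fixes_nonreal_unique[OF preimage_SL2[OF B(1)], of z "moebius_map A z"]
      moebius_uhp[OF AS z(2)] z q B p by auto
  qed
  have "q \<in> Some ` \<real> \<union> {None}"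
    using pb unfolding q_def
    by (auto simp: sphere_act_def moebius_map_def aut_factor_def split: option.splits intro!: imageI Reals_divide)
  moreover have "\<exists>\<^sub>F B in at (mat 1). B \<in> SL2_preimage \<Gamma> \<and> sphere_act B p = p \<and> sphere_act B q = q \<and> B \<noteq> - mat 1"
    using near by (rule frequently_mono[rotated]) (use p q in auto)
  ultimately show ?thesis using that[OF pb] q A Aq by (auto simp: q_def)
qed

text \<open>Moving the pair to infinity and 0 makes the swapping element an inversion and the small
  elements dilations, as \<open>powr_if_dilations_and_inversion\<close> requires.\<close>

lemma M_u_conj_powr:
  assumes \<Gamma>: "subgroup \<Gamma> PSL2" "\<not> discrete_subgroup \<Gamma>" "elementary \<Gamma>"
    and \<nu>: "multiplier_system \<Gamma> k \<nu>"
    and nf: "\<And>p. \<exists>A \<in> SL2_preimage \<Gamma>. sphere_act A p \<noteq> p"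
  obtains L where "L \<in> carrier SL2"
    "\<And>f. f \<in> M_u \<Gamma> k \<nu> \<Longrightarrow> \<exists>c. slash k L f = mero_scale c (mero_of (\<lambda>z. z powr of_real (- k / 2)))"
proof -
  obtain p q A where pq: "p \<in> Some ` \<real> \<union> {None}" "q \<in> Some ` \<real> \<union> {None}" "p \<noteq> q"
    and A: "A \<in> SL2_preimage \<Gamma>" "sphere_act A p = q" "sphere_act A q = p"
    and near: "\<exists>\<^sub>F B in at (mat 1). B \<in> SL2_preimage \<Gamma> \<and> sphere_act B p = p \<and> sphere_act B q = q \<and> B \<noteq> - mat 1"
    using swapped_boundary_pair[OF \<Gamma> nf] .
  obtain L where L: "L \<in> carrier SL2" "sphere_act L None = p" "sphere_act L (Some 0) = q"
    using transitive_on_boundary_pairs[OF pq] .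
  show ?thesis
  proof (rule that[OF L(1)])
    fix f assume f: "f \<in> M_u \<Gamma> k \<nu>"
    define g where "g = mero_fun (slash k L f)"
    have aut: "cmod_automorphic k (adj2 L ** X ** L) g" if "X \<in> SL2_preimage \<Gamma>" for X
      using that cmod_automorphic_slash[OF M_u_cmod_automorphic[OF \<nu> f] preimage_SL2 L(1)]
      by (simp add: g_def)
    define W where "W = adj2 L ** A ** L"
    have W: "W \<in> carrier SL2" using conj_SL2[OF L(1)] preimage_SL2 A by (simp add: W_def)
    have "sphere_act W None = Some 0" "sphere_act W (Some 0) = None"
      using A L preimage_SL2[OF A(1)] by (auto simp: W_def sphere_act_conj)
    hence W0: "W$1$1 = 0" "W$2$2 = 0" "W$2$1 \<noteq> 0"
      by (auto simp: sphere_act_def aut_factor_def split: if_splits)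
    hence W12: "W$1$2 = - 1 / W$2$1" using W by (simp add: carrier_SL2 field_simps)
    obtain C where C: "\<And>z. z \<in> uhp \<Longrightarrow> g z = C * z powr of_real (- k / 2)"
    \<comment> \<open>The antidiagonal matrix \<open>W\<close> acts as \<open>z\<close> to
      \<open>- b / z\<close> with \<open>b = 1 / (W$2$1)^2\<close>, and its automorphy factor is
      \<open>W$2$1 * z\<close>.\<close>
    proof (rule powr_if_dilations_and_inversion[of g "1 / (W$2$1)^2" "\<bar>W$2$1\<bar> powr k" k])
      show "g nicely_meromorphic_on uhp" unfolding g_def by (rule nicely_mero_fun)
      show "0 < 1 / (W$2$1)^2" "0 < \<bar>W$2$1\<bar> powr k" using W0 by auto
      show "cmod (g (- of_real (1 / (W$2$1)^2) / z)) = \<bar>W$2$1\<bar> powr k * cmod z powr k * cmod (g z)"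
        if z: "z \<in> uhp" for z
      proof -
        have "moebius_map W z = - of_real (1 / (W$2$1)^2) / z"
          using W0 by (simp add: moebius_map_def aut_factor_def W12 power2_eq_square)
        moreover have "cmod (aut_factor W z) = \<bar>W$2$1\<bar> * cmod z"
          by (simp add: aut_factor_def W0 norm_mult)
        ultimately show ?thesis
          using aut[OF A(1)] z unfolding W_def[symmetric] cmod_automorphic_def by (metis powr_mult)
      qed
      fix e :: real assume e: "e > 0"
      \<comment> \<open>A diagonal conjugate acts as dilation by \<open>(a B)^2\<close>, which tends
        to 1 as \<open>B\<close> tends to the identity.\<close>
      define a where "a B = (adj2 L ** B ** L) $ 1 $ 1" for B
      have "isCont (\<lambda>B. (a B)^2) (mat 1)"
        unfolding a_def matrix2_mult_nth by (intro continuous_intros)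
      moreover have "a (mat 1) = 1" using L by (simp add: a_def adj2_mult matrix_mul_rid)
      ultimately have "(\<lambda>B. (a B)^2) \<midarrow>mat 1\<rightarrow> 1" by (simp add: isCont_def)
      hence "\<forall>\<^sub>F B in at (mat 1). dist ((a B)^2) 1 < e" using e by (rule tendstoD)
      moreover have "\<forall>\<^sub>F B in at (mat 1). B \<noteq> (mat 1 :: real^2^2)" by (simp add: eventually_at_filter)
      ultimately have "\<forall>\<^sub>F B in at (mat 1).
          B \<in> SL2_preimage \<Gamma> \<and> sphere_act B p = p \<and> sphere_act B q = q \<and> B \<noteq> - mat 1 \<longrightarrow>
          (B \<in> SL2_preimage \<Gamma> \<and> sphere_act B p = p \<and> sphere_act B q = q \<and> B \<noteq> - mat 1)
          \<and> dist ((a B)^2) 1 < e \<and> B \<noteq> mat 1"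
        by eventually_elim blast
      hence "\<exists>\<^sub>F B in at (mat 1).
          (B \<in> SL2_preimage \<Gamma> \<and> sphere_act B p = p \<and> sphere_act B q = q \<and> B \<noteq> - mat 1)
          \<and> dist ((a B)^2) 1 < e \<and> B \<noteq> mat 1"
        by (rule frequently_rev_mp[OF near])
      then obtain B where B: "B \<in> SL2_preimage \<Gamma>" "sphere_act B p = p" "sphere_act B q = q" "B \<noteq> - mat 1" "B \<noteq> mat 1"
        "\<bar>(a B)^2 - 1\<bar> < e" by (auto dest: frequently_ex simp: dist_real_def)
      define X where "X = adj2 L ** B ** L"
      have X: "X \<in> carrier SL2" using conj_SL2[OF L(1)] preimage_SL2 B by (simp add: X_def)
      have "sphere_act X None = None" "sphere_act X (Some 0) = Some 0"
        using B L preimage_SL2[OF B(1)] by (auto simp: X_def sphere_act_conj)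
      hence X0: "X$2$1 = 0" "X$1$2 = 0"
        by (auto simp: sphere_act_def aut_factor_def moebius_map_def split: if_splits)
      note mX = moebius_upper_triangular[OF X X0(1)]
      have aX: "a B = X$1$1" by (simp add: a_def X_def)
      \<comment> \<open>Otherwise \<open>X\<close>, and with it \<open>B\<close>, would be the
        identity up to sign.\<close>
      have "(a B)^2 \<noteq> 1"
      proof
        assume "(a B)^2 = 1"
        hence "X$1$1 = 1 \<or> X$1$1 = -1" by (simp add: aX power2_eq_1_iff)
        hence "X = mat 1 \<or> X = - mat 1" using X0 mX(3) by (auto simp: matrix2_eq_iff)
        hence "L ** X = L \<or> L ** X = - L" by (auto simp: matrix_mul_rid matrix_minus_mult)
        hence "B ** L = L \<or> B ** L = - L" using conj_SL2(2)[OF L(1) preimage_SL2[OF B(1)]] by (simp add: X_def)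
        hence "B ** L ** adj2 L = L ** adj2 L \<or> B ** L ** adj2 L = - L ** adj2 L" by auto
        hence "B = mat 1 \<or> B = - mat 1"
          by (simp add: matrix_mul_assoc[symmetric] adj2_mult L(1) matrix_mul_rid matrix_minus_mult)
        thus False using B by blast
      qed
      moreover have "cmod (g (of_real ((a B)^2) * z)) = \<bar>X$2$2\<bar> powr k * cmod (g z)" if "z \<in> uhp" for z
        using aut[OF B(1)] that
        by (simp add: X_def[symmetric] cmod_automorphic_def mX(1,2) aX X0)
      ultimately show "\<exists>a K::real. a > 0 \<and> a \<noteq> 1 \<and> \<bar>a - 1\<bar> < e \<and> K > 0 \<and>
          (\<forall>z\<in>uhp. cmod (g (of_real a * z)) = K * cmod (g z))"
        using B(6) mX(3,4) aX by (intro exI[of _ "(a B)^2"] exI[of _ "\<bar>X$2$2\<bar> powr k"]) auto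
    qed blast
    have "slash k L f = mero_scale C (mero_of (\<lambda>z. z powr of_real (- k / 2)))"
      by (rule mero_ext) (simp only: mero_fun_scale mero_fun_mero_of_powr C[unfolded g_def])
    thus "\<exists>c. slash k L f = mero_scale c (mero_of (\<lambda>z. z powr of_real (- k / 2)))" ..
  qed
qed

section \<open>Dimension and generator\<close>

theorem theorem9p4:
  fixes \<Gamma> :: "(real^2^2) set set" and k :: real and \<nu> :: "real^2^2 \<Rightarrow> complex"
  assumes "subgroup \<Gamma> PSL2"
    and "\<not> comm_group (PSL2\<lparr>carrier := \<Gamma>\<rparr>)"
    and "\<not> discrete_subgroup \<Gamma>"
    and "elementary \<Gamma>"
    and "k \<noteq> 0"
    and "multiplier_system \<Gamma> k \<nu>"
  shows "((\<Inter>\<gamma>\<in>\<Gamma>. Fix \<gamma>) = {} \<and> M_u \<Gamma> k \<nu> \<noteq> {0} \<longrightarrow>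
            mero.dim (M_u \<Gamma> k \<nu>) = 1 \<and>
            (\<exists>L \<in> carrier SL2. slash k L ` M_u \<Gamma> k \<nu>
               = mero.span {mero_of (\<lambda>z. z powr of_real (- k / 2))}))
       \<and> ((\<Inter>\<gamma>\<in>\<Gamma>. Fix \<gamma>) \<noteq> {} \<longrightarrow> M_u \<Gamma> k \<nu> = {0})"
proof (intro conjI impI)
  assume "(\<Inter>\<gamma>\<in>\<Gamma>. Fix \<gamma>) \<noteq> {}"
  then obtain p where "\<And>A. A \<in> SL2_preimage \<Gamma> \<Longrightarrow> sphere_act A p = p"
    unfolding Inter_Fix[OF assms(1)] by blast
  hence "M_u \<Gamma> k \<nu> \<subseteq> {0}"
    using M_u_zero_if_common_fixed_point[OF assms(1,2,5,6)] by blast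
  thus "M_u \<Gamma> k \<nu> = {0}" using mero.subspace_0[OF subspace_M_u] by blast
next
  define P where "P = mero_of (\<lambda>z. z powr of_real (- k / 2))"
  assume *: "(\<Inter>\<gamma>\<in>\<Gamma>. Fix \<gamma>) = {} \<and> M_u \<Gamma> k \<nu> \<noteq> {0}"
  hence "\<exists>A \<in> SL2_preimage \<Gamma>. sphere_act A p \<noteq> p" for p
    unfolding Inter_Fix[OF assms(1)] by blast
  then obtain L where L: "L \<in> carrier SL2"
    and c: "\<And>f. f \<in> M_u \<Gamma> k \<nu> \<Longrightarrow> \<exists>c. slash k L f = mero_scale c P"
    using M_u_conj_powr[OF assms(1,3,4,6)] unfolding P_def by metis
  \<comment> \<open>A nonzero form is sent to a nonzero multiple of \<open>P\<close>, so all
    multiples of \<open>P\<close> are images of multiples of \<open>f0\<close>. Injectivity of the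
    slash then makes \<open>f0\<close> a basis.\<close>
  obtain f0 where f0: "f0 \<in> M_u \<Gamma> k \<nu>" "f0 \<noteq> 0"
    using * mero.subspace_0[OF subspace_M_u] by blast
  obtain c0 where c0: "slash k L f0 = mero_scale c0 P" using c[OF f0(1)] by blast
  have s0: "slash k L 0 = 0" using slash_scale[OF L, of k 0 0] by simp
  have "c0 \<noteq> 0"
  proof
    assume "c0 = 0"
    hence "slash k L f0 = slash k L 0" using c0 s0 by simp
    thus False using slash_inj[OF L] f0 by blast
  qed
  hence P: "mero_scale c P = slash k L (mero_scale (c / c0) f0)" for c
    by (simp add: slash_scale[OF L] c0)
  have M: "mero_scale c f0 \<in> M_u \<Gamma> k \<nu>" for c
    using mero.subspace_scale[OF subspace_M_u f0(1)] .
  have "M_u \<Gamma> k \<nu> \<subseteq> mero.span {f0}"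
  proof
    fix f assume "f \<in> M_u \<Gamma> k \<nu>"
    then obtain c where "slash k L f = mero_scale c P" using c by blast
    hence "f = mero_scale (c / c0) f0" using P slash_inj[OF L] by metis
    thus "f \<in> mero.span {f0}" by (auto simp: mero.span_singleton)
  qed
  hence "M_u \<Gamma> k \<nu> = mero.span {f0}" using M by (auto simp: mero.span_singleton)
  moreover have "mero.independent {f0}" using f0 by (simp add: mero.dependent_single)
  ultimately show "mero.dim (M_u \<Gamma> k \<nu>) = 1"
    using mero.dim_span_eq_card_independent by fastforce
  have "slash k L ` M_u \<Gamma> k \<nu> = mero.span {P}"
    unfolding mero.span_singleton using c P M by (auto simp: image_iff)
  thus "\<exists>L \<in> carrier SL2. slash k L ` M_u \<Gamma> k \<nu>
      = mero.span {mero_of (\<lambda>z. z powr of_real (- k / 2))}"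
    using L unfolding P_def by blast
qed

end
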